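(* Let $(\gamma,\eta):[0,c]\rightarrow X\times S$ be a Legendre immersion with curvature pair $(\alpha,\kappa)$, and assume that $\kappa$ does not vanish. For any $d\in\mathbb{R}$, the map $(\sigma,\xi):[0,c]\rightarrow X\times S$, where $\xi(t)=b(\eta(t))$ and $$\sigma(t)=\gamma(0)-\int_0^t\left(\int_0^s\alpha(\tau)\,d\tau\right)\xi'(s)\,ds+d\,\xi(t),$$ is a Legendre immersion with curvature pair $$\left(\kappa(t)\rho(\eta(t))\left(-d+\int_0^t\alpha(\tau)\,d\tau\right),\ -\kappa(t)\rho(\eta(t))\right):[0,c]\to\mathbb{R}^2.$$ Moreover, $(\sigma,\xi)$ is an involute of $(\gamma,\eta)$.
   Context: Let $(X,\|\cdot\|)$ be a two-dimensional real normed space with unit circle $S=\{x\in X:\|x\|=1\}$. The plane is assumed smooth ($S$ is a smooth curve) and strictly convex ($S$ contains no line segment). Fix a nondegenerate symplectic (alternating) bilinear form $[\cdot,\cdot]$ on $X$. For $x,y\in X$, $x\dashv_B y$ (Birkhoff orthogonality) means $\|x+ty\|\ge\|x\|$ for all $t\in\mathbb{R}$. For $v\in X\setminus\{o\}$ let $b(v)\in S$ be the unique vector with $v\dashv_B b(v)$ and $[v,b(v)]>0$. Define $\rho:S\to\mathbb{R}$ by $\rho(v)=\|\mathrm{D}b_v(b(v))\|$, where $\mathrm{D}b_v$ is the differential of $b$ at $v$. A Legendre curve is a smooth map $(\gamma,\eta):I\rightarrow X\times S$ ($I$ an interval) with $\eta(t)\dashv_B\gamma'(t)$ for all $t\in I$;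 it is a Legendre immersion if $\gamma'$ and $\eta'$ never vanish simultaneously. The curvature pair of $(\gamma,\eta)$ is the pair of smooth functions $(\alpha,\kappa)$ with $\gamma'(t)=\alpha(t)b(\eta(t))$ and $\eta'(t)=\kappa(t)b(\eta(t))$. The evolute of a Legendre immersion $(\gamma,\eta)$ with curvature pair $(\alpha,\kappa)$, $\kappa$ nowhere zero, is the curve $e_\gamma(t)=\gamma(t)-\frac{\alpha(t)}{\kappa(t)}\eta(t)$. An involute of a Legendre immersion $(\gamma,\eta):[0,c]\to X\times S$ whose curvature function $\kappa$ does not vanish is a Legendre immersion whose evolute is $(\gamma,\eta)$, in the sense that its evolute curve is $\gamma$.
   Formalization: The signs of both entries of the curvature pair are reversed (the printed signs fail already in the Euclidean plane), and ρ(η(t)) ≠ 0 on [0,c] is assumed, since where it vanishes ξ' and σ' both vanish and (σ,ξ) is not a Legendre immersion. *)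

theory Defs
  imports "HOL-Analysis.Analysis"
begin

text \<open>
  The normed plane is a type \<open>'a::real_normed_vector\<close> with \<open>dim (UNIV :: 'a set) = 2\<close>, so that
  \<open>norm\<close> is an arbitrary (not necessarily Euclidean) norm.  "Smooth" means \<open>C\<^sup>\<infinity>\<close>; derivatives of
  maps on an interval \<open>I\<close> are taken within \<open>I\<close>, i.e. one-sidedly at endpoints belonging to \<open>I\<close>.
\<close>

definition smooth_curve_on :: "real set \<Rightarrow> (real \<Rightarrow> 'a::real_normed_vector) \<Rightarrow> bool" where
  "smooth_curve_on I f \<longleftrightarrow>
     (\<exists>D :: nat \<Rightarrow> real \<Rightarrow> 'a. (\<forall>t\<in>I. D 0 t = f t) \<and>
        (\<forall>n. \<forall>t\<in>I. (D n has_vector_derivative D (Suc n) t) (at t within I)))"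

text \<open>The unit circle is a smooth curve: it is the trace of a regular \<open>C\<^sup>\<infinity>\<close> parametrization.\<close>

definition smooth_unit_circle :: "'a::real_normed_vector itself \<Rightarrow> bool" where
  "smooth_unit_circle TYPE('a) \<longleftrightarrow>
     (\<exists>\<phi> :: real \<Rightarrow> 'a. smooth_curve_on UNIV \<phi> \<and>
        (\<forall>t. vector_derivative \<phi> (at t) \<noteq> 0) \<and> range \<phi> = sphere 0 1)"

definition strictly_convex_unit_circle :: "'a::real_normed_vector itself \<Rightarrow> bool" where
  "strictly_convex_unit_circle TYPE('a) \<longleftrightarrow>
     (\<forall>x y :: 'a. x \<noteq> y \<longrightarrow> \<not> closed_segment x y \<subseteq> sphere 0 1)"

definition symplectic_form :: "('a::real_vector \<Rightarrow> 'a \<Rightarrow> real) \<Rightarrow> bool" where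
  "symplectic_form \<omega> \<longleftrightarrow>
     bilinear \<omega> \<and> (\<forall>x. \<omega> x x = 0) \<and> (\<forall>x. (\<forall>y. \<omega> x y = 0) \<longrightarrow> x = 0)"

definition birkhoff_orth :: "'a::real_normed_vector \<Rightarrow> 'a \<Rightarrow> bool" where
  "birkhoff_orth x y \<longleftrightarrow> (\<forall>t::real. norm (x + t *\<^sub>R y) \<ge> norm x)"

definition birkhoff_map :: "('a::real_normed_vector \<Rightarrow> 'a \<Rightarrow> real) \<Rightarrow> 'a \<Rightarrow> 'a" where
  "birkhoff_map \<omega> v = (THE w. norm w = 1 \<and> birkhoff_orth v w \<and> \<omega> v w > 0)"

text \<open>
  \<open>rho\<close> is the norm of the derivative of the unit tangent field along the unit circle.  Differentiating
  \<open>birkhoff_map \<omega>\<close> at a unit vector \<open>v\<close> in direction \<open>b v\<close> gives \<open>+ rho v\<close> times \<open>b (b v)\<close>: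
  both \<open>v\<close> and \<open>b v\<close> run through the circle in the positive sense.  Smoothness and strict convexity do
  not exclude isolated zeros of \<open>rho\<close> (e.g. at the points \<open>(1, 0)\<close> and \<open>(0, 1)\<close> for the
  \<open>\<ell>\<^sub>4\<close> norm).
\<close>

definition rho :: "('a::real_normed_vector \<Rightarrow> 'a \<Rightarrow> real) \<Rightarrow> 'a \<Rightarrow> real" where
  "rho \<omega> v = norm (frechet_derivative (birkhoff_map \<omega>) (at v) (birkhoff_map \<omega> v))"

definition legendre_curve_on ::
    "real set \<Rightarrow> (real \<Rightarrow> 'a::real_normed_vector) \<Rightarrow> (real \<Rightarrow> 'a) \<Rightarrow> bool" where
  "legendre_curve_on I \<gamma> \<eta> \<longleftrightarrow>
     smooth_curve_on I \<gamma> \<and> smooth_curve_on I \<eta> \<and>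
     (\<forall>t\<in>I. norm (\<eta> t) = 1 \<and> birkhoff_orth (\<eta> t) (vector_derivative \<gamma> (at t within I)))"

definition legendre_immersion_on ::
    "real set \<Rightarrow> (real \<Rightarrow> 'a::real_normed_vector) \<Rightarrow> (real \<Rightarrow> 'a) \<Rightarrow> bool" where
  "legendre_immersion_on I \<gamma> \<eta> \<longleftrightarrow>
     legendre_curve_on I \<gamma> \<eta> \<and>
     (\<forall>t\<in>I. \<not> (vector_derivative \<gamma> (at t within I) = 0 \<and>
                vector_derivative \<eta> (at t within I) = 0))"

definition curvature_pair_on ::
    "('a::real_normed_vector \<Rightarrow> 'a \<Rightarrow> real) \<Rightarrow> real set \<Rightarrow>
     (real \<Rightarrow> 'a) \<Rightarrow> (real \<Rightarrow> 'a) \<Rightarrow> (real \<Rightarrow> real) \<Rightarrow> (real \<Rightarrow> real) \<Rightarrow> bool" where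
  "curvature_pair_on \<omega> I \<gamma> \<eta> \<alpha> \<kappa> \<longleftrightarrow>
     smooth_curve_on I \<alpha> \<and> smooth_curve_on I \<kappa> \<and>
     (\<forall>t\<in>I. (\<gamma> has_vector_derivative \<alpha> t *\<^sub>R birkhoff_map \<omega> (\<eta> t)) (at t within I) \<and>
            (\<eta> has_vector_derivative \<kappa> t *\<^sub>R birkhoff_map \<omega> (\<eta> t)) (at t within I))"

definition evolute ::
    "(real \<Rightarrow> 'a::real_normed_vector) \<Rightarrow> (real \<Rightarrow> 'a) \<Rightarrow> (real \<Rightarrow> real) \<Rightarrow> (real \<Rightarrow> real) \<Rightarrow>
     real \<Rightarrow> 'a" where
  "evolute \<gamma> \<eta> \<alpha> \<kappa> t = \<gamma> t - (\<alpha> t / \<kappa> t) *\<^sub>R \<eta> t"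

text \<open>
  \<open>(\<sigma>, \<xi>)\<close> is an involute of \<open>(\<gamma>, \<eta>)\<close>.  The evolute of \<open>(\<sigma>, \<xi>)\<close> is only defined when its
  own curvature function does not vanish, hence the condition on \<open>\<kappa>'\<close>.
\<close>

definition involute_on ::
    "('a::real_normed_vector \<Rightarrow> 'a \<Rightarrow> real) \<Rightarrow> real set \<Rightarrow>
     (real \<Rightarrow> 'a) \<Rightarrow> (real \<Rightarrow> 'a) \<Rightarrow> (real \<Rightarrow> 'a) \<Rightarrow> (real \<Rightarrow> 'a) \<Rightarrow> bool" where
  "involute_on \<omega> I \<sigma> \<xi> \<gamma> \<eta> \<longleftrightarrow>
     legendre_immersion_on I \<gamma> \<eta> \<and>
     (\<exists>\<alpha> \<kappa>. curvature_pair_on \<omega> I \<gamma> \<eta> \<alpha> \<kappa> \<and> (\<forall>t\<in>I. \<kappa> t \<noteq> 0)) \<and>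
     legendre_immersion_on I \<sigma> \<xi> \<and>
     (\<exists>\<alpha>' \<kappa>'. curvature_pair_on \<omega> I \<sigma> \<xi> \<alpha>' \<kappa>' \<and> (\<forall>t\<in>I. \<kappa>' t \<noteq> 0) \<and>
        (\<forall>t\<in>I. evolute \<sigma> \<xi> \<alpha>' \<kappa>' t = \<gamma> t))"

end

theory Submission
  imports Defs
begin

text \<open>
  Write \<open>b\<close> for the Birkhoff map, \<open>\<xi> = b \<circ> \<eta>\<close> and \<open>A t\<close> for the integral of \<open>\<alpha>\<close> over \<open>{0..t}\<close>. Everything
  rests on one geometric fact, \<open>frechet_derivative_birkhoff_map\<close>: at a point \<open>v\<close> of the unit circle the
  derivative of \<open>b\<close> in direction \<open>b v\<close> is \<open>rho v\<close> times \<open>b (b v)\<close>. With the chain rule and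
  \<open>\<eta>' = \<kappa> b(\<eta>)\<close> it gives \<open>\<xi>' = \<kappa> rho(\<eta>) b(\<xi>)\<close>.

  The remaining computation is short. Because \<open>\<gamma>' = \<alpha> \<xi>\<close> and \<open>A' = \<alpha>\<close>, the integrand \<open>A \<xi>'\<close> is the derivative
  of \<open>A \<xi> - \<gamma>\<close>, so \<open>\<sigma> = \<gamma> + (d - A) \<xi>\<close>. Hence \<open>\<sigma>' = (d - A) \<xi>' = (d - A) \<kappa> rho(\<eta>) b(\<xi>)\<close>, which is the
  curvature pair, and the quotient of the two curvatures is \<open>d - A\<close>, so that subtracting
  \<open>(d - A) \<xi>\<close> from \<open>\<sigma>\<close> returns \<open>\<gamma>\<close>.

  What needs work is regularity. Smoothness of the circle is given only as a regular smooth
  parametrization \<open>\<phi>\<close>, from which differentiability of \<open>b\<close> on the plane and smoothness of \<open>rho(\<eta>)\<close> must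
  be derived. The first step identifies \<open>b (\<phi> s)\<close> as the unit tangent vector
  (\<open>birkhoff_map_\<phi>\<close>). The second is a local polar chart (\<open>polar_chart\<close>), obtained from a projective
  coordinate by the inverse function theorem in one variable. The norm of a nonvanishing smooth curve
  is then smooth (\<open>times_differentiable_on_norm\<close>) and \<open>b\<close> is differentiable away from \<open>0\<close>
  (\<open>birkhoff_map_differentiable\<close>). Finally \<open>\<xi> = \<eta>' / \<kappa>\<close> is smooth, and \<open>rho(\<eta>)\<close> is the norm of the
  smooth nonvanishing curve \<open>\<xi>' / \<kappa>\<close>.
\<close>

section \<open>Smoothness of curves, one order at a time\<close>

text \<open>
  A derivative of every finite order suffices for smoothness, so closure properties of smooth curves
  can be proved one order at a time. Order \<open>0\<close> asks for nothing, not even continuity, which keeps the base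
  case of every induction trivial. Demanding some derivative, in place of the value of
  \<^const>\<open>vector_derivative\<close>, makes the notion stable under restriction to arbitrary subsets, including
  those with isolated points, where derivatives are not unique.
\<close>
primrec times_differentiable_on :: "nat \<Rightarrow> real set \<Rightarrow> (real \<Rightarrow> 'b::real_normed_vector) \<Rightarrow> bool" where
  "times_differentiable_on 0 I f \<longleftrightarrow> True"
| "times_differentiable_on (Suc k) I f \<longleftrightarrow>
     (\<exists>f'. (\<forall>t\<in>I. (f has_vector_derivative f' t) (at t within I)) \<and> times_differentiable_on k I f')"

lemma times_differentiable_on_SucI:
  assumes "\<And>t. t \<in> I \<Longrightarrow> (f has_vector_derivative f' t) (at t within I)"
    and "times_differentiable_on k I f'"
  shows "times_differentiable_on (Suc k) I f"
  using assms by auto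

lemma times_differentiable_on_SucE:
  assumes "times_differentiable_on (Suc k) I f"
  obtains f' where "\<And>t. t \<in> I \<Longrightarrow> (f has_vector_derivative f' t) (at t within I)"
    and "times_differentiable_on k I f'"
  using assms by auto

lemma times_differentiable_on_cong:
  assumes "times_differentiable_on k I f" and "\<And>t. t \<in> I \<Longrightarrow> g t = f t"
  shows "times_differentiable_on k I g"
  using assms
proof (cases k)
  case (Suc j)
  then obtain f' where f': "\<And>t. t \<in> I \<Longrightarrow> (f has_vector_derivative f' t) (at t within I)"
    "times_differentiable_on j I f'" using assms(1) by auto
  then have "(g has_vector_derivative f' t) (at t within I)" if "t \<in> I" for t
    using that assms(2) by (auto intro: has_vector_derivative_transform)
  then show ?thesis unfolding Suc using f'(2) by (rule times_differentiable_on_SucI)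
qed simp

lemma times_differentiable_on_subset:
  "times_differentiable_on k I f \<Longrightarrow> J \<subseteq> I \<Longrightarrow> times_differentiable_on k J f"
proof (induction k arbitrary: f)
  case (Suc k)
  then obtain f' where "\<And>t. t \<in> I \<Longrightarrow> (f has_vector_derivative f' t) (at t within I)"
    "times_differentiable_on k I f'" by auto
  with Suc show ?case
    by (intro times_differentiable_on_SucI[where f'=f'])
       (auto intro: has_vector_derivative_within_subset)
qed simp

lemma times_differentiable_on_Suc_imp:
  "times_differentiable_on (Suc k) I f \<Longrightarrow> times_differentiable_on k I f"
proof (induction k arbitrary: f)
  case (Suc k)
  then obtain f' where "\<And>t. t \<in> I \<Longrightarrow> (f has_vector_derivative f' t) (at t within I)"
    "times_differentiable_on (Suc k) I f'" by auto
  then show ?case using Suc.IH by (intro times_differentiable_on_SucI)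
qed simp

lemma times_differentiable_on_const: "times_differentiable_on k I (\<lambda>t. c)"
proof (induction k arbitrary: c)
  case (Suc k)
  then show ?case by (intro times_differentiable_on_SucI[where f'="\<lambda>t. 0"]) auto
qed simp

lemma times_differentiable_on_add:
  "times_differentiable_on k I f \<Longrightarrow> times_differentiable_on k I g \<Longrightarrow>
   times_differentiable_on k I (\<lambda>t. f t + g t)"
proof (induction k arbitrary: f g)
  case (Suc k)
  from Suc.prems(1) obtain f' where f': "\<And>t. t \<in> I \<Longrightarrow> (f has_vector_derivative f' t) (at t within I)"
    "times_differentiable_on k I f'" by (rule times_differentiable_on_SucE) blast
  from Suc.prems(2) obtain g' where g': "\<And>t. t \<in> I \<Longrightarrow> (g has_vector_derivative g' t) (at t within I)"
    "times_differentiable_on k I g'" by (rule times_differentiable_on_SucE) blast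
  with f' Suc.IH show ?case
    by (intro times_differentiable_on_SucI[where f'="\<lambda>t. f' t + g' t"])
       (auto intro: has_vector_derivative_add)
qed simp

lemma (in bounded_bilinear) times_differentiable_on_prod:
  "times_differentiable_on k I f \<Longrightarrow> times_differentiable_on k I g \<Longrightarrow>
   times_differentiable_on k I (\<lambda>t. prod (f t) (g t))"
proof (induction k arbitrary: f g)
  case (Suc k)
  from Suc.prems(1) obtain f' where f': "\<And>t. t \<in> I \<Longrightarrow> (f has_vector_derivative f' t) (at t within I)"
    "times_differentiable_on k I f'" by (rule times_differentiable_on_SucE) blast
  from Suc.prems(2) obtain g' where g': "\<And>t. t \<in> I \<Longrightarrow> (g has_vector_derivative g' t) (at t within I)"
    "times_differentiable_on k I g'" by (rule times_differentiable_on_SucE) blast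
  note d = f' g'
  from Suc.prems have "times_differentiable_on k I f" "times_differentiable_on k I g"
    by (blast intro: times_differentiable_on_Suc_imp)+
  with d Suc.IH show ?case
    by (intro times_differentiable_on_SucI[where f'="\<lambda>t. prod (f t) (g' t) + prod (f' t) (g t)"])
       (auto intro: has_vector_derivative times_differentiable_on_add)
qed simp

lemmas times_differentiable_on_mult =
  bounded_bilinear.times_differentiable_on_prod[OF bounded_bilinear_mult]
lemmas times_differentiable_on_scaleR =
  bounded_bilinear.times_differentiable_on_prod[OF bounded_bilinear_scaleR]

lemma times_differentiable_on_inverse:
  fixes f :: "real \<Rightarrow> real"
  assumes nz: "\<And>t. t \<in> I \<Longrightarrow> f t \<noteq> 0"
  shows "times_differentiable_on k I f \<Longrightarrow> times_differentiable_on k I (\<lambda>t. inverse (f t))"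
proof (induction k)
  case (Suc k)
  then obtain f' where f': "\<And>t. t \<in> I \<Longrightarrow> (f has_vector_derivative f' t) (at t within I)"
    "times_differentiable_on k I f'" by auto
  have inv: "times_differentiable_on k I (\<lambda>t. inverse (f t))"
    using Suc by (blast intro: times_differentiable_on_Suc_imp)
  have "((\<lambda>t. inverse (f t)) has_vector_derivative (- 1) * f' t * inverse (f t) * inverse (f t))
          (at t within I)" if "t \<in> I" for t
    using DERIV_inverse_fun[of f "f' t" t I] f'(1)[OF that] nz[OF that]
    by (simp add: has_real_derivative_iff_has_vector_derivative power2_eq_square mult_ac)
  moreover have "times_differentiable_on k I (\<lambda>t. (- 1) * f' t * inverse (f t) * inverse (f t))"
    by (intro times_differentiable_on_mult times_differentiable_on_const f'(2) inv)
  ultimately show ?case by (rule times_differentiable_on_SucI)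
qed simp

lemma times_differentiable_on_compose:
  fixes g :: "real \<Rightarrow> real"
  shows "times_differentiable_on k J f \<Longrightarrow> times_differentiable_on k I g \<Longrightarrow> g ` I \<subseteq> J \<Longrightarrow>
    times_differentiable_on k I (\<lambda>t. f (g t))"
proof (induction k arbitrary: f)
  case (Suc k)
  from Suc.prems(1) obtain f' where f': "\<And>t. t \<in> J \<Longrightarrow> (f has_vector_derivative f' t) (at t within J)"
    "times_differentiable_on k J f'" by (rule times_differentiable_on_SucE) blast
  from Suc.prems(2) obtain g' where g': "\<And>t. t \<in> I \<Longrightarrow> (g has_vector_derivative g' t) (at t within I)"
    "times_differentiable_on k I g'" by (rule times_differentiable_on_SucE) blast
  note d = f' g'
  have "((\<lambda>t. f (g t)) has_vector_derivative g' t *\<^sub>R f' (g t)) (at t within I)" if "t \<in> I" for t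
  proof -
    have "(f has_vector_derivative f' (g t)) (at (g t) within g ` I)"
      using d(1)[of "g t"] that Suc.prems(3)
      by (auto intro: has_vector_derivative_within_subset)
    from vector_diff_chain_within[OF d(3)[OF that] this] show ?thesis by (simp add: o_def)
  qed
  moreover have "times_differentiable_on k I g"
    using Suc.prems by (blast intro: times_differentiable_on_Suc_imp)
  ultimately show ?case using d Suc
    by (intro times_differentiable_on_SucI[where f'="\<lambda>t. g' t *\<^sub>R f' (g t)"]
          times_differentiable_on_scaleR) auto
qed simp

lemma smooth_curve_on_imp_times_differentiable:
  assumes "smooth_curve_on I f"
  shows "times_differentiable_on k I f"
proof -
  from assms obtain D where D: "\<And>t. t \<in> I \<Longrightarrow> D 0 t = f t"
    "\<And>n t. t \<in> I \<Longrightarrow> (D n has_vector_derivative D (Suc n) t) (at t within I)"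
    unfolding smooth_curve_on_def by blast
  have "times_differentiable_on k I (D n)" for n
    using D(2) by (induction k arbitrary: n) (simp, blast intro: times_differentiable_on_SucI)
  from times_differentiable_on_cong[OF this] D(1) show ?thesis by metis
qed

lemma times_differentiable_on_vector_derivative:
  assumes perfect: "\<And>t. t \<in> I \<Longrightarrow> at t within I \<noteq> bot"
    and f: "times_differentiable_on (Suc k) I f"
  shows "\<And>t. t \<in> I \<Longrightarrow>
      (f has_vector_derivative vector_derivative f (at t within I)) (at t within I)"
    and "times_differentiable_on k I (\<lambda>t. vector_derivative f (at t within I))"
proof -
  from f obtain f' where f': "\<And>t. t \<in> I \<Longrightarrow> (f has_vector_derivative f' t) (at t within I)"
    "times_differentiable_on k I f'" by auto
  then have eq: "vector_derivative f (at t within I) = f' t" if "t \<in> I" for t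
    using that perfect by (blast intro: vector_derivative_within)
  show "times_differentiable_on k I (\<lambda>t. vector_derivative f (at t within I))"
    using f'(2) eq by (rule times_differentiable_on_cong)
  show "(f has_vector_derivative vector_derivative f (at t within I)) (at t within I)" if "t \<in> I" for t
    using f'(1) eq that by simp
qed

text \<open>
  Without isolated points derivatives are unique, so the derivatives chosen for different orders agree
  and fit together into one sequence, namely the iterates of \<^const>\<open>vector_derivative\<close>.
\<close>
lemma smooth_curve_on_iff_times_differentiable:
  assumes perfect: "\<And>t. t \<in> I \<Longrightarrow> at t within I \<noteq> bot"
  shows "smooth_curve_on I f \<longleftrightarrow> (\<forall>k. times_differentiable_on k I f)"
proof
  assume f: "\<forall>k. times_differentiable_on k I f"
  define D where "D = rec_nat f (\<lambda>_ g t. vector_derivative g (at t within I))"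
  have D_simps: "D 0 = f" "D (Suc n) = (\<lambda>t. vector_derivative (D n) (at t within I))" for n
    by (auto simp: D_def)
  have D: "times_differentiable_on k I (D n)" for n k
  proof (induction n arbitrary: k)
    case (Suc n)
    show ?case unfolding D_simps
      using perfect Suc by (rule times_differentiable_on_vector_derivative(2))
  qed (simp add: D_simps f)
  have "(D n has_vector_derivative D (Suc n) t) (at t within I)" if "t \<in> I" for n t
    unfolding D_simps using times_differentiable_on_vector_derivative(1)[OF perfect D that] .
  then show "smooth_curve_on I f"
    unfolding smooth_curve_on_def by (intro exI[of _ D]) (auto simp: D_simps)
qed (simp add: smooth_curve_on_imp_times_differentiable)

text \<open>
  This permits charts that exist only near a point. Uniqueness of the derivative glues the local
  derivatives to a global one, which is why isolated points are excluded.
\<close>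
lemma times_differentiable_on_local:
  assumes "\<And>t. t \<in> I \<Longrightarrow> at t within I \<noteq> bot"
    and "\<And>t. t \<in> I \<Longrightarrow> \<exists>U. open U \<and> t \<in> U \<and> times_differentiable_on k (I \<inter> U) f"
  shows "times_differentiable_on k I f"
  using assms(2)
proof (induction k arbitrary: f)
  case (Suc k)
  have at_eq: "at t within I \<inter> U = at t within I" if "open U" "t \<in> U" for U t
    using that by (intro at_within_nhd[of t U]) auto
  define f' where "f' t = vector_derivative f (at t within I)" for t
  have loc: "(f has_vector_derivative f' t) (at t within I) \<and>
      (\<exists>U. open U \<and> t \<in> U \<and> times_differentiable_on k (I \<inter> U) f')" if t: "t \<in> I" for t
  proof -
    from Suc.prems[OF t] obtain U where U: "open U" "t \<in> U"
      and d: "times_differentiable_on (Suc k) (I \<inter> U) f" by blast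
    have perfect: "at s within (I \<inter> U) \<noteq> bot" if "s \<in> I \<inter> U" for s
      using at_eq[of U s] U assms(1) that by auto
    have eq: "f' s = vector_derivative f (at s within (I \<inter> U))" if "s \<in> I \<inter> U" for s
      using that U at_eq by (simp add: f'_def)
    show ?thesis
      using times_differentiable_on_vector_derivative(1)[OF perfect d, of t] U t eq[of t]
        at_eq[OF U] times_differentiable_on_cong[OF
          times_differentiable_on_vector_derivative(2)[OF perfect d] eq]
      by auto
  qed
  show ?case
    by (rule times_differentiable_on_SucI[where f'=f']) (use loc Suc.IH in auto)
qed simp

text \<open>
  Injectivity comes from Rolle's theorem. The inverse \<open>h\<close> satisfies \<open>h' = 1 / g' \<circ> h\<close>, whose right-hand
  side is as often differentiable as \<open>h\<close> itself; this gains one order at each step.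
\<close>
lemma smooth_inverse_function:
  fixes g g' :: "real \<Rightarrow> real"
  assumes deriv: "\<And>s. s \<in> {a<..<b} \<Longrightarrow> (g has_real_derivative g' s) (at s)"
    and nonzero: "\<And>s. s \<in> {a<..<b} \<Longrightarrow> g' s \<noteq> 0"
    and smooth: "\<And>k. times_differentiable_on k {a<..<b} g'"
  obtains h where "open (g ` {a<..<b})"
    and "\<forall>s\<in>{a<..<b}. h (g s) = s"
    and "\<forall>k. times_differentiable_on k (g ` {a<..<b}) h"
proof -
  let ?A = "{a<..<b}"
  have cont: "continuous_on S g" if "S \<subseteq> ?A" for S
    using DERIV_isCont[OF deriv] that by (intro continuous_at_imp_continuous_on) blast
  have neq: "g x \<noteq> g y" if "x \<in> ?A" "y \<in> ?A" "x < y" for x y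
  proof
    assume eq: "g x = g y"
    have "continuous_on {x..y} g" using that by (intro cont) auto
    moreover have "(g has_derivative (*) (g' z)) (at z)" if "x < z" "z < y" for z
      using deriv[of z] that \<open>x \<in> ?A\<close> \<open>y \<in> ?A\<close> by (simp add: has_field_derivative_def)
    ultimately have "\<exists>z>x. z < y \<and> (*) (g' z) = (\<lambda>v. 0)"
      using \<open>x < y\<close> eq by (intro Rolle_deriv)
    then obtain z where z: "x < z" "z < y" "(*) (g' z) = (\<lambda>v. 0)" by blast
    from fun_cong[OF z(3), of 1] nonzero[of z] z(1,2) that show False by auto
  qed
  have inj: "inj_on g ?A"
  proof (rule inj_onI)
    fix x y assume "x \<in> ?A" "y \<in> ?A" "g x = g y"
    then show "x = y" using neq[of x y] neq[of y x] by (cases x y rule: linorder_cases) auto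
  qed
  define h where "h = inv_into ?A g"
  have h: "h (g s) = s" if "s \<in> ?A" for s
    using that inj by (simp add: h_def)
  have opn: "open (g ` ?A)"
    using cont[of ?A] inj by (intro invariance_of_domain) auto
  have h_deriv: "(h has_vector_derivative inverse (g' (h y))) (at y within g ` ?A)"
    if "y \<in> g ` ?A" for y
  proof -
    from that obtain s where s: "s \<in> ?A" "y = g s" by blast
    have "(h has_derivative (*) (inverse (g' s))) (at (g s))"
    proof (rule has_derivative_inverse_strong[where f=g and x=s and S="?A"])
      show "open ?A" "s \<in> ?A" "continuous_on ?A g" using s cont[of ?A] by auto
      show "h (g x) = x" if "x \<in> ?A" for x using h that .
      show "(g has_derivative (*) (g' s)) (at s)"
        using deriv[OF s(1)] by (simp add: has_field_derivative_def)
      show "(*) (g' s) \<circ> (*) (inverse (g' s)) = id"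
        using nonzero[OF s(1)] by (simp add: fun_eq_iff)
    qed
    then have "(h has_real_derivative inverse (g' s)) (at (g s))"
      by (simp add: has_field_derivative_def)
    then show ?thesis
      using s h by (auto simp: has_real_derivative_iff_has_vector_derivative
          intro: has_vector_derivative_at_within)
  qed
  have "times_differentiable_on k (g ` ?A) h" for k
  proof (induction k)
    case (Suc k)
    have sub: "h ` g ` ?A \<subseteq> ?A" using h by auto
    then have "times_differentiable_on k (g ` ?A) (\<lambda>y. inverse (g' (h y)))"
      using sub nonzero
      by (intro times_differentiable_on_inverse times_differentiable_on_compose[OF smooth Suc]) blast+
    with h_deriv show ?case by (rule times_differentiable_on_SucI)
  qed simp
  with opn h show thesis by (intro that[of h]) simp_all
qed

section \<open>Symplectic planes\<close>

locale symplectic_plane =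
  fixes \<omega> :: "'a::real_normed_vector \<Rightarrow> 'a \<Rightarrow> real"
  assumes dim_plane: "dim (UNIV :: 'a set) = 2"
    and symplectic: "symplectic_form \<omega>"
begin

lemma \<omega>_linear [simp]:
  "\<omega> (x + y) z = \<omega> x z + \<omega> y z" "\<omega> z (x + y) = \<omega> z x + \<omega> z y"
  "\<omega> (x - y) z = \<omega> x z - \<omega> y z" "\<omega> z (x - y) = \<omega> z x - \<omega> z y"
  "\<omega> (r *\<^sub>R x) z = r * \<omega> x z" "\<omega> z (r *\<^sub>R x) = r * \<omega> z x"
  "\<omega> 0 z = 0" "\<omega> z 0 = 0" "\<omega> x x = 0"
proof -
  have lin: "linear (\<lambda>x. \<omega> x z)" "linear (\<omega> z)"
    using symplectic unfolding symplectic_form_def bilinear_def by auto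
  show "\<omega> (x + y) z = \<omega> x z + \<omega> y z" "\<omega> z (x + y) = \<omega> z x + \<omega> z y"
    "\<omega> (x - y) z = \<omega> x z - \<omega> y z" "\<omega> z (x - y) = \<omega> z x - \<omega> z y"
    "\<omega> (r *\<^sub>R x) z = r * \<omega> x z" "\<omega> z (r *\<^sub>R x) = r * \<omega> z x"
    "\<omega> 0 z = 0" "\<omega> z 0 = 0"
    using linear_add[OF lin(1)] linear_add[OF lin(2)] linear_diff[OF lin(1)] linear_diff[OF lin(2)]
      linear_scale[OF lin(1)] linear_scale[OF lin(2)] linear_0[OF lin(1)] linear_0[OF lin(2)]
    by auto
  show "\<omega> x x = 0" using symplectic unfolding symplectic_form_def by blast
qed

lemma \<omega>_antisym: "\<omega> x y = - \<omega> y x"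
proof -
  have "\<omega> (x + y) (x + y) = 0" using \<omega>_linear(9) .
  then show ?thesis by (simp only: \<omega>_linear(1,2)) simp
qed

text \<open>
  If \<open>x\<close> and \<open>y\<close> were independent they would span the plane, and \<open>x\<close> would lie in the kernel of the
  form.
\<close>
lemma parallel_if_\<omega>_zero:
  assumes "\<omega> x y = 0" and "x \<noteq> 0"
  obtains r where "y = r *\<^sub>R x"
proof -
  have "y \<in> span {x}"
  proof (rule ccontr)
    assume y: "y \<notin> span {x}"
    then have xy: "independent {y, x}" and neq: "x \<noteq> y"
      using \<open>x \<noteq> 0\<close> by (auto simp: independent_insert span_base)
    obtain T :: "'a set" where T: "card T = 2" "span T = UNIV" "independent T"
      using dim_plane basis_exists[of "UNIV :: 'a set"] by (metis top.extremum_uniqueI)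
    then have "finite T" by (metis card.infinite zero_neq_numeral)
    have "span {y, x} = UNIV"
    proof (rule ccontr)
      assume "span {y, x} \<noteq> UNIV"
      then obtain z where z: "z \<notin> span {y, x}" by blast
      then have "independent {z, y, x}" using xy \<open>x \<noteq> 0\<close> by (simp add: independent_insert span_base)
      then have "card {z, y, x} \<le> 2"
        using independent_span_bound[OF \<open>finite T\<close>] T by auto
      moreover have "z \<noteq> x" "z \<noteq> y" using z by (auto simp: span_base)
      ultimately show False using neq by simp
    qed
    then have "\<exists>a b. z = a *\<^sub>R x + b *\<^sub>R y" for z
      using span_breakdown_eq[of z y "{x}"] by (fastforce simp: span_singleton diff_eq_eq)
    then have "\<omega> x z = 0" for z
      using assms(1) by (metis \<omega>_linear(2,6,9) mult_zero_right add_0)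
    then show False
      using symplectic \<open>x \<noteq> 0\<close> unfolding symplectic_form_def by blast
  qed
  then show thesis using that by (auto simp: span_singleton)
qed

lemma coordinates:
  assumes "\<omega> e f \<noteq> 0"
  shows "x = (\<omega> x f / \<omega> e f) *\<^sub>R e + (\<omega> e x / \<omega> e f) *\<^sub>R f"
proof -
  define y where "y = x - ((\<omega> x f / \<omega> e f) *\<^sub>R e + (\<omega> e x / \<omega> e f) *\<^sub>R f)"
  have "\<omega> e y = 0" "\<omega> y f = 0" using assms by (auto simp: y_def)
  moreover have "e \<noteq> 0" using assms by auto
  ultimately obtain r where "y = r *\<^sub>R e" using parallel_if_\<omega>_zero by metis
  with \<open>\<omega> y f = 0\<close> assms have "y = 0" by auto
  then show ?thesis by (simp add: y_def)
qed

text \<open>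
  The two-dimensional Plucker relation. It bounds \<open>\<omega>\<close> by its values against a fixed basis, and it is the
  numerator that arises when a quotient of two linear functionals is differentiated along a curve.
\<close>
lemma grassmann_identity: "\<omega> e f * \<omega> x y = \<omega> x f * \<omega> e y - \<omega> e x * \<omega> y f"
proof (cases "\<omega> e f = 0")
  case False
  have "\<omega> x y = \<omega> ((\<omega> x f / \<omega> e f) *\<^sub>R e + (\<omega> e x / \<omega> e f) *\<^sub>R f)
                 ((\<omega> y f / \<omega> e f) *\<^sub>R e + (\<omega> e y / \<omega> e f) *\<^sub>R f)"
    using coordinates[OF False] by metis
  with False show ?thesis
    by (simp add: \<omega>_antisym[of f e] field_simps del: \<omega>_linear(3,4))
next
  case True
  show ?thesis
  proof (cases "e = 0")
    case False
    with True obtain r where "f = r *\<^sub>R e" using parallel_if_\<omega>_zero by metis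
    then show ?thesis by (simp add: \<omega>_antisym[of _ e])
  qed simp
qed

lemma birkhoff_map_scaleR:
  assumes "r > 0"
  shows "birkhoff_map \<omega> (r *\<^sub>R v) = birkhoff_map \<omega> v"
proof -
  have "birkhoff_orth (r *\<^sub>R v) w \<longleftrightarrow> birkhoff_orth v w" for w :: 'a
  proof -
    have eq: "norm (r *\<^sub>R v + t *\<^sub>R w) = r * norm (v + (t / r) *\<^sub>R w)" for t
    proof -
      have "r *\<^sub>R v + t *\<^sub>R w = r *\<^sub>R (v + (t / r) *\<^sub>R w)"
        using assms by (simp add: scaleR_add_right)
      then show ?thesis using assms by simp
    qed
    have "birkhoff_orth (r *\<^sub>R v) w \<longleftrightarrow> (\<forall>t. norm v \<le> norm (v + (t / r) *\<^sub>R w))"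
      using assms unfolding birkhoff_orth_def eq by simp
    also have "\<dots> \<longleftrightarrow> birkhoff_orth v w"
      unfolding birkhoff_orth_def using assms
      by (metis nonzero_mult_div_cancel_right less_irrefl)
    finally show ?thesis .
  qed
  then show ?thesis using assms by (simp add: birkhoff_map_def zero_less_mult_iff)
qed

end

section \<open>The parametrized unit circle and its supporting lines\<close>

lemma has_real_derivative_zero_if_bounded:
  fixes r :: "real \<Rightarrow> 'b::real_normed_vector" and q :: "real \<Rightarrow> real"
  assumes "(r has_vector_derivative 0) (at a)" and "r a = 0"
    and "eventually (\<lambda>h. \<bar>q h\<bar> \<le> norm (r h)) (at a)" and "q a = 0"
  shows "(q has_real_derivative 0) (at a)"
proof -
  have "((\<lambda>h. norm (r h) / norm (h - a)) \<longlongrightarrow> 0) (at a)"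
    using assms(1,2) by (simp add: has_vector_derivative_def has_derivative_at2 divide_inverse mult.commute
      has_derivative_iff_norm)
  moreover have "eventually (\<lambda>h. norm (q h / (h - a)) \<le> norm (r h) / norm (h - a)) (at a)"
    using assms(3) by eventually_elim (simp add: divide_right_mono)
  ultimately have "((\<lambda>h. q h / (h - a)) \<longlongrightarrow> 0) (at a)"
    by (rule Lim_null_comparison[rotated])
  then show ?thesis by (simp add: has_field_derivative_iff \<open>q a = 0\<close>)
qed

locale parametrized_unit_circle = symplectic_plane \<omega>
  for \<omega> :: "'a::real_normed_vector \<Rightarrow> 'a \<Rightarrow> real" +
  fixes \<phi> \<phi>' :: "real \<Rightarrow> 'a"
  assumes \<phi>_smooth: "smooth_curve_on UNIV \<phi>"
    and \<phi>_deriv: "\<And>s. (\<phi> has_vector_derivative \<phi>' s) (at s)"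
    and \<phi>'_nonzero: "\<And>s. \<phi>' s \<noteq> 0"
    and range_\<phi>: "range \<phi> = sphere 0 1"
begin

abbreviation b :: "'a \<Rightarrow> 'a" where "b \<equiv> birkhoff_map \<omega>"

lemma norm_\<phi> [simp]: "norm (\<phi> s) = 1"
  using range_\<phi> rangeI[of \<phi> s] by simp

lemma polar_form:
  obtains s where "v = norm v *\<^sub>R \<phi> s"
proof (cases "v = 0")
  case False
  then have "(1 / norm v) *\<^sub>R v \<in> range \<phi>" by (simp add: range_\<phi>)
  then obtain s where "(1 / norm v) *\<^sub>R v = \<phi> s" by auto
  then have "v = norm v *\<^sub>R \<phi> s" using False by (metis nonzero_mult_div_cancel_left
    norm_eq_zero scaleR_scaleR scaleR_one times_divide_eq_right mult.right_neutral)
  then show thesis using that by blast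
qed (use that in simp)

text \<open>
  To first order the line through \<open>\<phi> s\<close> in direction \<open>a \<phi> s + \<phi>' s\<close> is the curve \<open>h \<mapsto> (1 + a h) \<phi> (s + h)\<close>,
  whose norm is \<open>1 + a h\<close>. So smoothness of the circle gives directional differentiability of the
  norm, with no prior knowledge that the norm is a smooth function.
\<close>
lemma norm_deriv_along_line:
  "((\<lambda>h. norm (\<phi> s + h *\<^sub>R (a *\<^sub>R \<phi> s + \<phi>' s))) has_real_derivative a) (at 0)"
proof -
  let ?r = "\<lambda>h. \<phi> s + h *\<^sub>R (a *\<^sub>R \<phi> s + \<phi>' s) - (1 + a * h) *\<^sub>R \<phi> (s + h)"
  let ?q = "\<lambda>h. norm (\<phi> s + h *\<^sub>R (a *\<^sub>R \<phi> s + \<phi>' s)) - (1 + a * h)"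
  have \<phi>: "((\<lambda>h. \<phi> (s + h)) has_vector_derivative \<phi>' s) (at 0)"
  proof -
    have "((\<lambda>h. s + h) has_vector_derivative 0 + 1) (at 0)" by (intro derivative_intros)
    from vector_diff_chain_at[OF this, of \<phi> "\<phi>' s"] \<phi>_deriv[of s] show ?thesis
      by (simp add: o_def)
  qed
  have "(?r has_vector_derivative 0) (at 0)"
    by (rule has_vector_derivative_eq_rhs, (rule derivative_intros \<phi>)+)
       (auto intro!: derivative_eq_intros simp: algebra_simps)
  moreover have "eventually (\<lambda>h. \<bar>?q h\<bar> \<le> norm (?r h)) (at 0)"
  proof -
    have "((\<lambda>h. 1 + a * h) \<longlongrightarrow> 1 + a * 0) (at 0)" by (intro tendsto_intros)
    then have "eventually (\<lambda>h. 1 + a * h > 0) (at 0)" by (rule order_tendstoD) simp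
    then show ?thesis
    proof eventually_elim
      case (elim h)
      then have "norm ((1 + a * h) *\<^sub>R \<phi> (s + h)) = 1 + a * h" by simp
      then show ?case by (metis norm_triangle_ineq3)
    qed
  qed
  ultimately have "(?q has_real_derivative 0) (at 0)"
    by (intro has_real_derivative_zero_if_bounded[where r="?r"]) auto
  moreover have "((\<lambda>h. 1 + a * h) has_real_derivative a) (at 0)"
    by (auto intro!: derivative_eq_intros)
  ultimately have "((\<lambda>h. ?q h + (1 + a * h)) has_real_derivative 0 + a) (at 0)"
    by (rule DERIV_add)
  then show ?thesis by simp
qed

text \<open>
  A tangent \<open>\<phi>' s = r \<phi> s\<close> would be radial; along the line of direction \<open>- r \<phi> s + \<phi>' s = 0\<close> the norm has
  derivative \<open>- r\<close> but is constant.
\<close>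
lemma \<omega>_\<phi>_\<phi>'_nonzero: "\<omega> (\<phi> s) (\<phi>' s) \<noteq> 0"
proof
  assume "\<omega> (\<phi> s) (\<phi>' s) = 0"
  moreover have "\<phi> s \<noteq> 0" using norm_\<phi>[of s] by force
  ultimately obtain r where r: "\<phi>' s = r *\<^sub>R \<phi> s" using parallel_if_\<omega>_zero by metis
  from norm_deriv_along_line[of s "- r"] have "((\<lambda>h. 1) has_real_derivative - r) (at 0)"
    by (simp add: r)
  then have "r = 0" using DERIV_unique[of "\<lambda>_. 1" "- r" 0 0] by simp
  with r \<phi>'_nonzero[of s] show False by simp
qed

text \<open>A convex function with a critical point has its minimum there.\<close>
lemma birkhoff_orth_tangent: "birkhoff_orth (\<phi> s) (\<phi>' s)"
  unfolding birkhoff_orth_def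
proof
  fix t
  let ?N = "\<lambda>h. norm (\<phi> s + h *\<^sub>R \<phi>' s)"
  have "convex_on UNIV ?N"
  proof (rule convex_onI)
    fix u x y :: real assume u: "0 < u" "u < 1"
    have "\<phi> s + ((1 - u) *\<^sub>R x + u *\<^sub>R y) *\<^sub>R \<phi>' s
        = (1 - u) *\<^sub>R (\<phi> s + x *\<^sub>R \<phi>' s) + u *\<^sub>R (\<phi> s + y *\<^sub>R \<phi>' s)"
      by (simp add: algebra_simps)
    then show "?N ((1 - u) *\<^sub>R x + u *\<^sub>R y) \<le> (1 - u) * ?N x + u * ?N y"
      using u by (metis norm_triangle_ineq norm_scaleR abs_of_pos diff_gt_0_iff_gt)
  qed simp
  moreover have "(?N has_real_derivative 0) (at 0)"
    using norm_deriv_along_line[of s 0] by simp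
  ultimately have "?N t - ?N 0 \<ge> 0 * (t - 0)"
    by (intro convex_on_imp_above_tangent[where A=UNIV]) auto
  then show "norm (\<phi> s) \<le> norm (\<phi> s + t *\<^sub>R \<phi>' s)" by simp
qed

text \<open>
  At a minimum the directional derivative of the norm vanishes, which kills the radial component.
\<close>
lemma birkhoff_orth_imp_tangent:
  assumes "birkhoff_orth (\<phi> s) w"
  obtains r where "w = r *\<^sub>R \<phi>' s"
proof -
  obtain a c where w: "w = a *\<^sub>R \<phi> s + c *\<^sub>R \<phi>' s"
    using coordinates[OF \<omega>_\<phi>_\<phi>'_nonzero] by blast
  have "a = 0"
  proof (cases "c = 0")
    case True
    show ?thesis
    proof (rule ccontr)
      assume "a \<noteq> 0"
      then have "norm (\<phi> s + (- 1 / a) *\<^sub>R w) = 0" using True w by simp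
      with assms show False unfolding birkhoff_orth_def by (metis norm_\<phi> not_one_le_zero)
    qed
  next
    case False
    have "\<phi> s + h *\<^sub>R ((a / c) *\<^sub>R \<phi> s + \<phi>' s) = \<phi> s + (h / c) *\<^sub>R w" for h
      using False by (simp add: w algebra_simps)
    with norm_deriv_along_line[of s "a / c"]
    have "((\<lambda>h. norm (\<phi> s + (h / c) *\<^sub>R w)) has_real_derivative a / c) (at 0)" by simp
    moreover have "norm (\<phi> s + (0 / c) *\<^sub>R w) \<le> norm (\<phi> s + (h / c) *\<^sub>R w)" for h
      using assms unfolding birkhoff_orth_def by simp
    ultimately have "a / c = 0"
      by (intro DERIV_local_min[of _ "a / c" 0 1]) auto
    with False show ?thesis by simp
  qed
  with w show thesis by (intro that[of c]) simp
qed

text \<open>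
  The directions Birkhoff orthogonal from \<open>\<phi> s\<close> form the tangent line, so \<open>b (\<phi> s)\<close> is the unit tangent
  vector. The factor \<open>sgn\<close> appears because \<open>\<phi>\<close> may run through the circle in the negative sense.
\<close>
lemma birkhoff_map_\<phi>: "b (\<phi> s) = (sgn (\<omega> (\<phi> s) (\<phi>' s)) / norm (\<phi>' s)) *\<^sub>R \<phi>' s"
  and birkhoff_map_\<phi>_properties:
    "norm (b (\<phi> s)) = 1 \<and> birkhoff_orth (\<phi> s) (b (\<phi> s)) \<and> \<omega> (\<phi> s) (b (\<phi> s)) > 0"
proof -
  let ?J = "\<omega> (\<phi> s) (\<phi>' s)"
  let ?w = "(sgn ?J / norm (\<phi>' s)) *\<^sub>R \<phi>' s"
  let ?P = "\<lambda>w. norm w = 1 \<and> birkhoff_orth (\<phi> s) w \<and> \<omega> (\<phi> s) w > 0"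
  have P: "?P ?w"
    using birkhoff_orth_tangent[of s] \<omega>_\<phi>_\<phi>'_nonzero[of s] \<phi>'_nonzero[of s]
    by (auto simp: birkhoff_orth_def abs_sgn_eq sgn_mult_self_eq zero_less_mult_iff
        zero_less_divide_iff sgn_if)
  have "w = ?w" if w: "?P w" for w
  proof -
    from w obtain r where r: "w = r *\<^sub>R \<phi>' s" using birkhoff_orth_imp_tangent by metis
    with w have "\<bar>r\<bar> = 1 / norm (\<phi>' s)" and "0 < r * ?J"
      using \<phi>'_nonzero[of s] by (auto simp: field_simps)
    then have "r = sgn ?J / norm (\<phi>' s)"
      by (auto simp: zero_less_mult_iff sgn_if)
    with r show ?thesis by simp
  qed
  with P have "b (\<phi> s) = ?w" unfolding birkhoff_map_def by (intro the_equality) auto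
  then show "b (\<phi> s) = ?w" .
  with P show "?P (b (\<phi> s))" by simp
qed

lemma birkhoff_map_properties:
  assumes "v \<noteq> 0"
  shows norm_birkhoff_map: "norm (b v) = 1"
    and birkhoff_orth_birkhoff_map: "birkhoff_orth v (b v)"
    and \<omega>_birkhoff_map_pos: "\<omega> v (b v) > 0"
proof -
  obtain s where s: "v = norm v *\<^sub>R \<phi> s" by (rule polar_form)
  with assms have bv: "b v = b (\<phi> s)" by (metis birkhoff_map_scaleR zero_less_norm_iff)
  note P = birkhoff_map_\<phi>_properties[of s]
  show "norm (b v) = 1" using P bv by simp
  show "\<omega> v (b v) > 0" using P bv assms s by (metis \<omega>_linear(5) mult_pos_pos zero_less_norm_iff)
  show "birkhoff_orth v (b v)"
    unfolding birkhoff_orth_def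
  proof
    fix t
    have "norm (norm v *\<^sub>R \<phi> s + t *\<^sub>R b (\<phi> s))
        = norm (norm v *\<^sub>R (\<phi> s + (t / norm v) *\<^sub>R b (\<phi> s)))"
      using assms by (simp add: scaleR_add_right)
    also have "\<dots> = norm v * norm (\<phi> s + (t / norm v) *\<^sub>R b (\<phi> s))" by simp
    also have "\<dots> \<ge> norm v * 1"
      using P unfolding birkhoff_orth_def by (intro mult_left_mono) auto
    finally show "norm v \<le> norm (v + t *\<^sub>R b v)" using s bv by simp
  qed
qed

text \<open>
  The level lines of \<open>x \<mapsto> \<omega> x (b v)\<close> have direction \<open>b v\<close>, so by Birkhoff orthogonality the one through
  \<open>v\<close> supports the ball of radius \<open>norm v\<close>.
\<close>
lemma support_inequality:
  assumes "v \<noteq> 0"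
  shows "\<bar>\<omega> x (b v)\<bar> * norm v \<le> norm x * \<omega> v (b v)"
proof -
  let ?J = "\<omega> v (b v)"
  define A where "A = \<omega> x (b v) / ?J"
  define C where "C = \<omega> v x / ?J"
  have J: "?J > 0" using \<omega>_birkhoff_map_pos[OF assms] .
  have x: "x = A *\<^sub>R v + C *\<^sub>R b v" using coordinates[of v "b v" x] J by (simp add: A_def C_def)
  have "\<bar>A\<bar> * norm v \<le> norm x"
  proof (cases "A = 0")
    case False
    then have "x = A *\<^sub>R (v + (C / A) *\<^sub>R b v)" using x by (simp add: scaleR_add_right)
    then have "norm x = \<bar>A\<bar> * norm (v + (C / A) *\<^sub>R b v)" by (metis norm_scaleR)
    moreover have "norm v \<le> norm (v + (C / A) *\<^sub>R b v)"
      using birkhoff_orth_birkhoff_map[OF assms] by (simp add: birkhoff_orth_def)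
    ultimately show ?thesis by (simp add: mult_left_mono)
  qed simp
  then have "\<bar>A\<bar> * norm v * ?J \<le> norm x * ?J" using J by simp
  moreover have "\<bar>A\<bar> * ?J = \<bar>\<omega> x (b v)\<bar>" using J by (simp add: A_def abs_divide)
  ultimately show ?thesis by (metis mult.assoc mult.commute)
qed

text \<open>
  The coordinates with respect to \<open>e\<close> and \<open>b e\<close> are bounded by the support inequality at \<open>e\<close>, and
  \<open>grassmann_identity\<close> expresses \<open>\<omega>\<close> through them.
\<close>
lemma bounded_bilinear_\<omega>: "bounded_bilinear \<omega>"
proof
  define e f where "e = \<phi> 0" and "f = b e"
  have e0: "e \<noteq> 0" unfolding e_def using norm_\<phi>[of 0] by force
  have ne: "norm e = 1" and nf: "norm f = 1"
    using norm_birkhoff_map[OF e0] by (auto simp: e_def f_def)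
  have J: "\<omega> e f > 0" using \<omega>_birkhoff_map_pos[OF e0] by (simp add: f_def)
  have xf: "\<bar>\<omega> x f\<bar> \<le> norm x * \<omega> e f" for x
    using support_inequality[OF e0, of x] ne by (simp add: f_def)
  have ex: "\<bar>\<omega> e x\<bar> \<le> 2 * norm x * \<omega> e f" for x
  proof -
    have "(\<omega> e x / \<omega> e f) *\<^sub>R f = x - (\<omega> x f / \<omega> e f) *\<^sub>R e"
      using coordinates[of e f x] J by (simp add: algebra_simps)
    then have "norm ((\<omega> e x / \<omega> e f) *\<^sub>R f) \<le> norm x + norm ((\<omega> x f / \<omega> e f) *\<^sub>R e)"
      by (metis norm_triangle_ineq4)
    then have "\<bar>\<omega> e x\<bar> / \<omega> e f \<le> norm x + \<bar>\<omega> x f\<bar> / \<omega> e f"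
      using ne nf J by simp
    then have "\<bar>\<omega> e x\<bar> \<le> norm x * \<omega> e f + \<bar>\<omega> x f\<bar>" using J by (simp add: field_simps)
    with xf[of x] show ?thesis by simp
  qed
  have "norm (\<omega> x y) \<le> norm x * norm y * (4 * \<omega> e f)" for x y
  proof -
    have "\<omega> e f * \<bar>\<omega> x y\<bar> = \<bar>\<omega> x f * \<omega> e y - \<omega> e x * \<omega> y f\<bar>"
      using grassmann_identity[of e f x y] J by (metis abs_mult abs_of_pos)
    also have "\<dots> \<le> \<bar>\<omega> x f\<bar> * \<bar>\<omega> e y\<bar> + \<bar>\<omega> e x\<bar> * \<bar>\<omega> y f\<bar>"
      by (metis abs_mult abs_triangle_ineq4)
    also have "\<dots> \<le> (norm x * \<omega> e f) * (2 * norm y * \<omega> e f)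
                    + (2 * norm x * \<omega> e f) * (norm y * \<omega> e f)"
      using J by (intro add_mono mult_mono xf ex) auto
    also have "\<dots> = \<omega> e f * (norm x * norm y * (4 * \<omega> e f))" by (simp add: algebra_simps)
    finally show ?thesis using J by simp
  qed
  then show "\<exists>K. \<forall>x y. norm (\<omega> x y) \<le> norm x * norm y * K" by blast
qed simp_all

lemmas has_vector_derivative_\<omega> = bounded_bilinear.has_vector_derivative[OF bounded_bilinear_\<omega>]
lemmas times_differentiable_on_\<omega> =
  bounded_bilinear.times_differentiable_on_prod[OF bounded_bilinear_\<omega>]
lemmas bounded_linear_\<omega>_left = bounded_bilinear.bounded_linear_left[OF bounded_bilinear_\<omega>]
lemmas bounded_linear_\<omega>_right = bounded_bilinear.bounded_linear_right[OF bounded_bilinear_\<omega>]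

subsection \<open>Polar charts and smoothness of the norm\<close>

lemma \<phi>_times_differentiable: "times_differentiable_on k S \<phi>"
  using smooth_curve_on_imp_times_differentiable[OF \<phi>_smooth] times_differentiable_on_subset by blast

lemma \<phi>'_times_differentiable: "times_differentiable_on k S \<phi>'"
proof -
  have "times_differentiable_on k UNIV (\<lambda>s. vector_derivative \<phi> (at s))"
    by (rule times_differentiable_on_vector_derivative(2)[OF _ \<phi>_times_differentiable]) simp
  then have "times_differentiable_on k UNIV \<phi>'"
    by (rule times_differentiable_on_cong) (metis \<phi>_deriv vector_derivative_at)
  then show ?thesis using times_differentiable_on_subset by blast
qed

lemma times_differentiable_\<omega>_\<phi>_\<phi>': "times_differentiable_on k S (\<lambda>s. \<omega> (\<phi> s) (\<phi>' s))"
  by (intro times_differentiable_on_\<omega> \<phi>_times_differentiable \<phi>'_times_differentiable)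

text \<open>
  The function \<open>g s0\<close> is an affine coordinate of the line through \<open>0\<close> and \<open>\<phi> s\<close>, that is, of a point of
  the projective line. By \<open>grassmann_identity\<close> its derivative is a nonvanishing multiple of
  \<open>\<omega> (\<phi> s) (\<phi>' s)\<close>, so near \<open>s0\<close> the parameter \<open>s\<close> can be smoothly recovered from the direction of \<open>\<phi> s\<close>.
\<close>
lemma projective_coordinate:
  defines "g s0 \<equiv> (\<lambda>s. \<omega> (\<phi> s0) (\<phi> s) * inverse (\<omega> (\<phi> s) (\<phi>' s0)))"
  obtains \<delta> h where "\<delta> > 0"
    and "\<forall>s\<in>{s0 - \<delta><..<s0 + \<delta>}. \<omega> (\<phi> s) (\<phi>' s0) / \<omega> (\<phi> s0) (\<phi>' s0) > 0"
    and "open (g s0 ` {s0 - \<delta><..<s0 + \<delta>})"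
    and "\<forall>s\<in>{s0 - \<delta><..<s0 + \<delta>}. h (g s0 s) = s"
    and "\<forall>k. times_differentiable_on k (g s0 ` {s0 - \<delta><..<s0 + \<delta>}) h"
proof -
  define e f where "e = \<phi> s0" and "f = \<phi>' s0"
  let ?P = "\<lambda>s. \<omega> (\<phi> s) f / \<omega> e f"
  let ?J = "\<lambda>s. \<omega> (\<phi> s) (\<phi>' s)"
  have ef: "\<omega> e f \<noteq> 0" using \<omega>_\<phi>_\<phi>'_nonzero by (simp add: e_def f_def)
  have d_left: "((\<lambda>s. \<omega> e (\<phi> s)) has_real_derivative \<omega> e (\<phi>' s)) (at s)"
    and d_right: "((\<lambda>s. \<omega> (\<phi> s) f) has_real_derivative \<omega> (\<phi>' s) f) (at s)" for s
    using has_vector_derivative_\<omega>[OF has_vector_derivative_const[of e] \<phi>_deriv[of s]]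
      has_vector_derivative_\<omega>[OF \<phi>_deriv[of s] has_vector_derivative_const[of f]]
    by (simp_all add: has_real_derivative_iff_has_vector_derivative)
  have "(?P \<longlongrightarrow> ?P s0) (at s0)"
    using DERIV_isCont[OF d_right[of s0]] ef by (intro tendsto_intros) (simp_all add: isCont_def)
  then have "eventually (\<lambda>s. ?P s > 0) (at s0)"
    using ef by (intro order_tendstoD(1)) (auto simp: e_def)
  then obtain \<delta> where \<delta>: "\<delta> > 0" "\<And>s. s \<noteq> s0 \<Longrightarrow> dist s s0 < \<delta> \<Longrightarrow> ?P s > 0"
    unfolding eventually_at by auto
  let ?A = "{s0 - \<delta><..<s0 + \<delta>}"
  have P: "?P s > 0" if "s \<in> ?A" for s
    using \<delta>(2)[of s] that ef by (cases "s = s0") (auto simp: dist_real_def e_def)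
  then have nz: "\<omega> (\<phi> s) f \<noteq> 0" if "s \<in> ?A" for s using that by force
  define g' where "g' s = \<omega> e f * ?J s * (inverse (\<omega> (\<phi> s) f) * inverse (\<omega> (\<phi> s) f))" for s
  have g': "(g s0 has_real_derivative g' s) (at s)" if "s \<in> ?A" for s
  proof -
    have "(g s0 has_real_derivative
        \<omega> e (\<phi>' s) * inverse (\<omega> (\<phi> s) f)
        + - (inverse (\<omega> (\<phi> s) f) * \<omega> (\<phi>' s) f * inverse (\<omega> (\<phi> s) f)) * \<omega> e (\<phi> s)) (at s)"
      unfolding g_def e_def[symmetric] f_def[symmetric]
      by (rule DERIV_mult[OF d_left DERIV_inverse'[OF d_right nz[OF that]]])
    moreover have "\<omega> e (\<phi>' s) * inverse (\<omega> (\<phi> s) f)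
        + - (inverse (\<omega> (\<phi> s) f) * \<omega> (\<phi>' s) f * inverse (\<omega> (\<phi> s) f)) * \<omega> e (\<phi> s) = g' s"
      using nz[OF that] unfolding g'_def grassmann_identity[of e f "\<phi> s" "\<phi>' s"]
      by (simp add: field_simps)
    ultimately show ?thesis by simp
  qed
  have g'_nz: "g' s \<noteq> 0" if "s \<in> ?A" for s
    using that ef nz \<omega>_\<phi>_\<phi>'_nonzero by (simp add: g'_def)
  have smooth: "times_differentiable_on k ?A g'" for k
    unfolding g'_def using nz
    by (intro times_differentiable_on_mult times_differentiable_on_inverse times_differentiable_on_const
        times_differentiable_\<omega>_\<phi>_\<phi>' times_differentiable_on_\<omega> \<phi>_times_differentiable)
  obtain h where "open (g s0 ` ?A)" "\<forall>s\<in>?A. h (g s0 s) = s"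
    "\<forall>k. times_differentiable_on k (g s0 ` ?A) h"
    by (rule smooth_inverse_function[OF g' g'_nz smooth])
  with \<delta>(1) P show thesis by (intro that[of \<delta> h]) (simp_all add: e_def f_def)
qed

text \<open>
  Polar coordinates adapted to the norm. The angle \<open>\<theta> x\<close> is the parameter of the point of the circle
  with the same projective coordinate as \<open>x\<close>; on the half-plane defining \<open>W1\<close> equal coordinates mean
  equal rays. The last property replaces smoothness of \<open>\<theta>\<close> as a function of two variables by its
  effect on curves, which is all that differentiation along curves requires.
\<close>
lemma polar_chart:
  assumes "v \<noteq> 0"
  obtains W :: "'a set" and \<theta> :: "'a \<Rightarrow> real" where "open W" and "v \<in> W" and "0 \<notin> W"
    and "\<forall>x\<in>W. x = norm x *\<^sub>R \<phi> (\<theta> x)"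
    and "\<forall>x\<in>W. \<theta> differentiable (at x)"
    and "\<forall>k I y. times_differentiable_on k I y \<longrightarrow> y ` I \<subseteq> W \<longrightarrow>
           times_differentiable_on k I (\<lambda>t. \<theta> (y t))"
proof -
  obtain s0 where s0: "v = norm v *\<^sub>R \<phi> s0" by (rule polar_form)
  define e f where "e = \<phi> s0" and "f = \<phi>' s0"
  have ef: "\<omega> e f \<noteq> 0" using \<omega>_\<phi>_\<phi>'_nonzero by (simp add: e_def f_def)
  define g where "g = (\<lambda>x. \<omega> e x * inverse (\<omega> x f))"
  obtain \<delta> h where \<delta>: "\<delta> > 0"
    and P: "\<forall>s\<in>{s0 - \<delta><..<s0 + \<delta>}. \<omega> (\<phi> s) f / \<omega> e f > 0"
    and opn: "open ((\<lambda>s. g (\<phi> s)) ` {s0 - \<delta><..<s0 + \<delta>})"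
    and h: "\<forall>s\<in>{s0 - \<delta><..<s0 + \<delta>}. h (g (\<phi> s)) = s"
    and h_smooth: "\<forall>k. times_differentiable_on k ((\<lambda>s. g (\<phi> s)) ` {s0 - \<delta><..<s0 + \<delta>}) h"
    unfolding g_def e_def f_def by (rule projective_coordinate[of s0])
  define A where "A = {s0 - \<delta><..<s0 + \<delta>}"
  define B where "B = (\<lambda>s. g (\<phi> s)) ` A"
  note P = bspec[OF P, folded A_def] and h = bspec[OF h, folded A_def]
    and opn = opn[folded A_def, folded B_def] and h_smooth = spec[OF h_smooth, folded A_def, folded B_def]
  define W1 where "W1 = {x. \<omega> x f / \<omega> e f > 0}"
  define W where "W = W1 \<inter> g -` B"
  define \<theta> where "\<theta> = (\<lambda>x. h (g x))"
  have W1: "\<omega> x f \<noteq> 0" if "x \<in> W1" for x using that by (auto simp: W1_def)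
  have cont: "continuous_on S (\<lambda>x. \<omega> x f)" "continuous_on S (\<omega> e)" for S
    using bounded_linear_\<omega>_left bounded_linear_\<omega>_right
    by (auto intro: linear_continuous_on)
  have "open W1" unfolding W1_def
    by (rule open_Collect_less) (auto intro!: continuous_intros cont simp: ef)
  moreover have "continuous_on W1 g"
    unfolding g_def using W1 by (intro continuous_intros cont) auto
  ultimately have "open W" unfolding W_def using opn by (intro continuous_open_preimage)
  moreover have "v \<in> W"
  proof -
    have "\<omega> v f = norm v * \<omega> e f" "\<omega> e v = norm v * 0"
      using arg_cong[OF s0, of "\<lambda>x. \<omega> x f"] arg_cong[OF s0, of "\<omega> e"] by (simp_all add: e_def)
    then have "\<omega> v f / \<omega> e f = norm v" and "g v = g (\<phi> s0)"
      using ef by (simp_all add: g_def e_def)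
    moreover have "s0 \<in> A" using \<delta> by (simp add: A_def)
    ultimately show ?thesis using assms by (auto simp: W_def W1_def B_def)
  qed
  moreover have "0 \<notin> W" by (simp add: W_def W1_def)
  moreover have "\<forall>x\<in>W. x = norm x *\<^sub>R \<phi> (\<theta> x)"
  proof
    fix x assume "x \<in> W"
    then obtain s where s: "s \<in> A" "g x = g (\<phi> s)" and x: "x \<in> W1"
      by (auto simp: W_def B_def)
    then have \<theta>: "\<theta> x = s" using h by (simp add: \<theta>_def)
    let ?c = "\<omega> x f / \<omega> (\<phi> s) f"
    have c: "?c > 0" using P[OF s(1)] x unfolding W1_def
      by (auto simp: zero_less_divide_iff)
    have on_ray: "y = (\<omega> y f / \<omega> e f) *\<^sub>R (e + g y *\<^sub>R f)" if "\<omega> y f \<noteq> 0" for y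
    proof -
      have "\<omega> y f / \<omega> e f * g y = \<omega> e y / \<omega> e f" using that by (simp add: g_def field_simps)
      then have "(\<omega> y f / \<omega> e f) *\<^sub>R (e + g y *\<^sub>R f)
          = (\<omega> y f / \<omega> e f) *\<^sub>R e + (\<omega> e y / \<omega> e f) *\<^sub>R f"
        by (simp only: scaleR_add_right scaleR_scaleR)
      also have "\<dots> = y" using coordinates[OF ef, of y] by (rule sym)
      finally show ?thesis by (rule sym)
    qed
    have nz: "\<omega> (\<phi> s) f \<noteq> 0" using c by force
    have "x = (\<omega> x f / \<omega> e f) *\<^sub>R (e + g x *\<^sub>R f)" using on_ray W1[OF x] .
    also have "\<dots> = ?c *\<^sub>R ((\<omega> (\<phi> s) f / \<omega> e f) *\<^sub>R (e + g (\<phi> s) *\<^sub>R f))"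
      using nz s(2) by simp
    also have "(\<omega> (\<phi> s) f / \<omega> e f) *\<^sub>R (e + g (\<phi> s) *\<^sub>R f) = \<phi> s" using on_ray[OF nz] by (rule sym)
    finally have x_eq: "x = ?c *\<^sub>R \<phi> s" .
    have "norm x = \<bar>?c\<bar> * norm (\<phi> s)"
      using arg_cong[OF x_eq, of norm] by (simp only: norm_scaleR)
    also have "\<bar>?c\<bar> = ?c" using c by (rule abs_of_pos)
    finally have "norm x *\<^sub>R \<phi> (\<theta> x) = ?c *\<^sub>R \<phi> s" by (simp only: \<theta> norm_\<phi> mult_1_right)
    with x_eq show "x = norm x *\<^sub>R \<phi> (\<theta> x)" by (rule trans[OF _ sym])
  qed
  moreover have "\<forall>x\<in>W. \<theta> differentiable (at x)"
  proof
    fix x assume that: "x \<in> W"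
    have nz: "\<omega> x f \<noteq> 0" using that W1 by (simp add: W_def)
    have left: "(\<lambda>x. \<omega> x f) differentiable (at x)"
      using bounded_linear_imp_has_derivative[OF bounded_linear_\<omega>_left] by (rule differentiableI)
    have right: "\<omega> e differentiable (at x)"
      using bounded_linear_imp_has_derivative[OF bounded_linear_\<omega>_right] by (rule differentiableI)
    have g_diff: "g differentiable (at x)"
      unfolding g_def using differentiable_mult[OF right differentiable_inverse[OF left nz]] .
    have gx: "g x \<in> B" using that by (simp add: W_def)
    obtain h' where h': "\<forall>t\<in>B. (h has_vector_derivative h' t) (at t within B)"
      using h_smooth[of "Suc 0"] unfolding times_differentiable_on.simps by blast
    have "(h has_vector_derivative h' (g x)) (at (g x))"
      using bspec[OF h' gx] by (simp only: at_within_open[OF gx opn])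
    then have "h differentiable (at (g x))" by (rule differentiableI_vector)
    with g_diff have "h \<circ> g differentiable (at x)" by (rule differentiable_chain_at)
    then show "\<theta> differentiable (at x)" by (simp add: \<theta>_def o_def)
  qed
  moreover have "\<forall>k I y. times_differentiable_on k I y \<longrightarrow> y ` I \<subseteq> W \<longrightarrow>
      times_differentiable_on k I (\<lambda>t. \<theta> (y t))"
  proof (intro allI impI)
    fix k I and y :: "real \<Rightarrow> 'a"
    assume y: "times_differentiable_on k I y" "y ` I \<subseteq> W"
    have "times_differentiable_on k I (\<lambda>t. g (y t))"
      unfolding g_def using y W1
      by (intro times_differentiable_on_mult times_differentiable_on_inverse times_differentiable_on_\<omega>
          times_differentiable_on_const y(1)) (auto simp: W_def)
    moreover have "(\<lambda>t. g (y t)) ` I \<subseteq> B" using y(2) by (auto simp: W_def)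
    ultimately show "times_differentiable_on k I (\<lambda>t. \<theta> (y t))"
      unfolding \<theta>_def by (rule times_differentiable_on_compose[OF h_smooth])
  qed
  ultimately show thesis by (rule that)
qed

text \<open>
  In a polar chart \<open>norm x = \<omega> x (\<phi>' (\<theta> x)) / \<omega> (\<phi> (\<theta> x)) (\<phi>' (\<theta> x))\<close>, an expression without norms.
\<close>
lemma times_differentiable_on_norm:
  fixes y :: "real \<Rightarrow> 'a"
  assumes perfect: "\<And>t. t \<in> I \<Longrightarrow> at t within I \<noteq> bot"
    and y: "times_differentiable_on k I y"
    and nonzero: "\<And>t. t \<in> I \<Longrightarrow> y t \<noteq> 0"
  shows "times_differentiable_on k I (\<lambda>t. norm (y t))"
proof (cases k)
  case (Suc j)
  then obtain y' where "\<And>t. t \<in> I \<Longrightarrow> (y has_vector_derivative y' t) (at t within I)"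
    using y by auto
  then have cont: "continuous_on I y"
    by (intro continuous_on_vector_derivative)
  show ?thesis
  proof (rule times_differentiable_on_local[OF perfect])
    fix t assume "t \<in> I"
    obtain W :: "'a set" and \<theta> where W: "open W" "y t \<in> W" "0 \<notin> W"
      and polar: "\<forall>x\<in>W. x = norm x *\<^sub>R \<phi> (\<theta> x)"
      and "\<forall>x\<in>W. \<theta> differentiable (at x)"
      and \<theta>: "\<forall>k I y. times_differentiable_on k I y \<longrightarrow> y ` I \<subseteq> W \<longrightarrow>
           times_differentiable_on k I (\<lambda>t. \<theta> (y t))"
      by (rule polar_chart[OF nonzero[OF \<open>t \<in> I\<close>]])
    from cont W(1) obtain U where U: "open U" "U \<inter> I = y -` W \<inter> I"
      unfolding continuous_on_open_invariant by blast
    let ?J = "\<lambda>s. \<omega> (\<phi> s) (\<phi>' s)"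
    have sub: "y ` (I \<inter> U) \<subseteq> W" using U(2) by blast
    have y_sub: "times_differentiable_on k (I \<inter> U) y"
      using y by (rule times_differentiable_on_subset) blast
    have \<theta>y: "times_differentiable_on k (I \<inter> U) (\<lambda>t. \<theta> (y t))"
      using \<theta> y_sub sub by blast
    have "times_differentiable_on k (I \<inter> U) (\<lambda>t. \<omega> (y t) (\<phi>' (\<theta> (y t))) * inverse (?J (\<theta> (y t))))"
      by (intro times_differentiable_on_mult times_differentiable_on_\<omega> y_sub
          times_differentiable_on_inverse \<omega>_\<phi>_\<phi>'_nonzero
          times_differentiable_on_compose[OF \<phi>'_times_differentiable[of _ UNIV] \<theta>y]
          times_differentiable_on_compose[OF \<phi>_times_differentiable[of _ UNIV] \<theta>y]) auto
    then have "times_differentiable_on k (I \<inter> U) (\<lambda>t. norm (y t))"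
    proof (rule times_differentiable_on_cong)
      fix t assume "t \<in> I \<inter> U"
      with sub have "\<omega> (y t) (\<phi>' (\<theta> (y t))) = norm (y t) * ?J (\<theta> (y t))"
        using polar by (metis \<omega>_linear(5) image_subset_iff)
      then show "norm (y t) = \<omega> (y t) (\<phi>' (\<theta> (y t))) * inverse (?J (\<theta> (y t)))"
        using \<omega>_\<phi>_\<phi>'_nonzero by simp
    qed
    moreover have "t \<in> U" using U(2) W(2) \<open>t \<in> I\<close> by blast
    ultimately show "\<exists>U. open U \<and> t \<in> U \<and> times_differentiable_on k (I \<inter> U) (\<lambda>t. norm (y t))"
      using U(1) by blast
  qed
qed simp

lemma birkhoff_map_\<phi>_differentiable: "(\<lambda>s. b (\<phi> s)) differentiable (at s)"
proof -
  let ?J = "\<lambda>s. \<omega> (\<phi> s) (\<phi>' s)"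
  have td: "F differentiable (at s)" if "times_differentiable_on (Suc 0) UNIV F"
    for F :: "real \<Rightarrow> 'c::real_normed_vector"
    using that by (auto intro: differentiableI_vector)
  have "continuous (at s) ?J"
    using td[OF times_differentiable_\<omega>_\<phi>_\<phi>'] by (rule differentiable_imp_continuous_within)
  then have "(?J \<longlongrightarrow> ?J s) (at s)" by (simp add: continuous_within)
  then have sgn_eq: "eventually (\<lambda>u. sgn (?J u) = sgn (?J s)) (at s)"
    using order_tendstoD[of ?J "?J s" "at s" 0] \<omega>_\<phi>_\<phi>'_nonzero[of s]
    by (cases "?J s > 0") (auto elim!: eventually_mono)
  let ?G = "\<lambda>u. (sgn (?J s) * inverse (norm (\<phi>' u))) *\<^sub>R \<phi>' u"
  have "times_differentiable_on (Suc 0) UNIV ?G"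
    using \<phi>'_nonzero
    by (intro times_differentiable_on_scaleR times_differentiable_on_mult times_differentiable_on_const
        times_differentiable_on_inverse times_differentiable_on_norm \<phi>'_times_differentiable) auto
  then have "?G differentiable (at s)" by (rule td)
  then obtain G' where "(?G has_derivative G') (at s)" unfolding differentiable_def by blast
  then have "((\<lambda>s. b (\<phi> s)) has_derivative G') (at s)"
    by (rule has_derivative_transform_eventually)
      (use sgn_eq in \<open>auto elim!: eventually_mono simp: birkhoff_map_\<phi> divide_inverse\<close>)
  then show ?thesis unfolding differentiable_def by blast
qed

text \<open>
  In a polar chart \<open>b\<close> is the unit tangent field composed with the angle, by homogeneity of degree zero.
\<close>
lemma birkhoff_map_differentiable:
  assumes "v \<noteq> 0"
  shows "b differentiable (at v)"
proof -
  obtain W :: "'a set" and \<theta> where W: "open W" "v \<in> W" "0 \<notin> W"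
    and polar: "\<forall>x\<in>W. x = norm x *\<^sub>R \<phi> (\<theta> x)"
    and \<theta>: "\<forall>x\<in>W. \<theta> differentiable (at x)"
    and "\<forall>k I y. times_differentiable_on k I y \<longrightarrow> y ` I \<subseteq> W \<longrightarrow>
           times_differentiable_on k I (\<lambda>t. \<theta> (y t))"
    by (rule polar_chart[OF assms])
  have "(\<lambda>s. b (\<phi> s)) \<circ> \<theta> differentiable (at v)"
    using bspec[OF \<theta> W(2)] birkhoff_map_\<phi>_differentiable by (rule differentiable_chain_at)
  then obtain D where D: "((\<lambda>s. b (\<phi> s)) \<circ> \<theta> has_derivative D) (at v)"
    unfolding differentiable_def by blast
  have "((\<lambda>s. b (\<phi> s)) \<circ> \<theta>) x = b x" if "x \<in> W" for x
  proof -
    have "norm x > 0" using that W(3) by auto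
    then show ?thesis using bspec[OF polar that] birkhoff_map_scaleR[of "norm x" "\<phi> (\<theta> x)"] by simp
  qed
  with D have "(b has_derivative D) (at v)"
    using has_derivative_transform_within_open[OF D W(1,2)] by metis
  then show ?thesis unfolding differentiable_def by blast
qed

subsection \<open>The derivative of the Birkhoff map\<close>

text \<open>
  Only the direction and the sign of the derivative need an argument, since \<open>rho\<close> is its norm by
  definition. Put \<open>w = b v\<close> and move \<open>v\<close> along the tangent line: \<open>B h = b (v + h w)\<close> starts at \<open>w\<close> and
  stays on the unit circle, so \<open>\<omega> (B h) (b w)\<close> is maximal at \<open>h = 0\<close>; its derivative vanishes, and
  \<open>B' 0\<close> is a multiple of \<open>b w\<close>.
  The multiple is nonnegative because \<open>b\<close> turns in the positive sense: for \<open>h > 0\<close> the support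
  inequality at \<open>v + h w\<close>, whose norm is at least that of \<open>v\<close>, gives \<open>\<omega> w (B h) \<ge> 0 = \<omega> w (B 0)\<close>.
\<close>
lemma frechet_derivative_birkhoff_map:
  assumes v: "v \<noteq> 0"
  shows "frechet_derivative b (at v) (b v) = rho \<omega> v *\<^sub>R b (b v)"
proof -
  define w where "w = b v"
  define D where "D = frechet_derivative b (at v)"
  define B where "B = (\<lambda>h. b (v + h *\<^sub>R w))"
  have w: "w \<noteq> 0" "norm w = 1" using norm_birkhoff_map[OF v] by (auto simp: w_def)
  have norm_ge: "norm v \<le> norm (v + h *\<^sub>R w)" for h
    using birkhoff_orth_birkhoff_map[OF v] by (simp add: birkhoff_orth_def w_def)
  then have nz: "v + h *\<^sub>R w \<noteq> 0" for h using v by (metis norm_le_zero_iff norm_zero)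
  have B0: "B 0 = w" by (simp add: B_def w_def)
  have "((\<lambda>h. v + h *\<^sub>R w) has_vector_derivative 0 + (0 *\<^sub>R 0 + 1 *\<^sub>R w)) (at 0)"
    by (auto intro!: derivative_eq_intros)
  then have line: "((\<lambda>h. v + h *\<^sub>R w) has_vector_derivative w) (at 0)" by simp
  have D: "(b has_derivative D) (at v)"
    unfolding D_def using birkhoff_map_differentiable[OF v] by (simp add: frechet_derivative_works)
  have B_deriv: "(B has_vector_derivative D w) (at 0)"
    using vector_derivative_diff_chain_within[OF line, of b D] D
    by (simp add: B_def o_def has_derivative_at_withinI)
  have "((\<lambda>h. \<omega> (B h) (b w)) has_real_derivative \<omega> (D w) (b w)) (at 0)"
    using has_vector_derivative_\<omega>[OF B_deriv has_vector_derivative_const]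
    by (simp add: has_real_derivative_iff_has_vector_derivative)
  moreover have "\<omega> (B h) (b w) \<le> \<omega> (B 0) (b w)" for h
  proof -
    have "\<bar>\<omega> (B h) (b w)\<bar> \<le> \<omega> w (b w)"
      using support_inequality[OF w(1), of "B h"] norm_birkhoff_map[OF nz] w by (simp add: B_def)
    then show ?thesis by (simp add: B0)
  qed
  ultimately have "\<omega> (D w) (b w) = 0"
    by (intro DERIV_local_max[of _ "\<omega> (D w) (b w)" 0 1]) auto
  then have "\<omega> (b w) (D w) = 0" using \<omega>_antisym[of "D w"] by simp
  moreover have "b w \<noteq> 0" using norm_birkhoff_map[OF w(1)] by auto
  ultimately obtain r where r: "D w = r *\<^sub>R b w" using parallel_if_\<omega>_zero by metis
  have "((\<lambda>h. \<omega> w (B h)) has_real_derivative \<omega> w (D w)) (at 0)"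
    using has_vector_derivative_\<omega>[OF has_vector_derivative_const B_deriv]
    by (simp add: has_real_derivative_iff_has_vector_derivative)
  moreover have "\<omega> w (B h) \<ge> 0" if h: "h > 0" for h
  proof -
    let ?x = "v + h *\<^sub>R w"
    have pos: "\<omega> ?x (b ?x) > 0" using \<omega>_birkhoff_map_pos[OF nz] .
    have "\<bar>\<omega> v (b ?x)\<bar> * norm ?x \<le> norm v * \<omega> ?x (b ?x)"
      using support_inequality[OF nz] .
    also have "\<dots> \<le> norm ?x * \<omega> ?x (b ?x)"
      using pos norm_ge by (intro mult_right_mono) auto
    finally have "\<omega> v (b ?x) \<le> \<omega> ?x (b ?x)" using nz[of h] by (simp add: mult.commute)
    then have "0 \<le> h * \<omega> w (b ?x)" by simp
    then show ?thesis using h by (simp add: B_def zero_le_mult_iff)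
  qed
  ultimately have "\<omega> w (D w) \<ge> 0"
  proof -
    assume d: "((\<lambda>h. \<omega> w (B h)) has_real_derivative \<omega> w (D w)) (at 0)"
      and pos: "\<And>h. h > 0 \<Longrightarrow> \<omega> w (B h) \<ge> 0"
    show ?thesis
    proof (rule ccontr)
      assume "\<not> ?thesis"
      then obtain \<delta> where \<delta>: "\<delta> > 0" "\<And>h. h > 0 \<Longrightarrow> h < \<delta> \<Longrightarrow> \<omega> w (B (0 + h)) < \<omega> w (B 0)"
        using DERIV_neg_dec_right[OF d] by auto
      with pos[of "\<delta> / 2"] \<delta>(2)[of "\<delta> / 2"] show False by (simp add: B0)
    qed
  qed
  then have "r \<ge> 0" using r \<omega>_birkhoff_map_pos[OF w(1)] by (simp add: zero_le_mult_iff)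
  then have "rho \<omega> v = r"
    using r norm_birkhoff_map[OF w(1)] by (simp add: rho_def D_def w_def)
  with r show ?thesis by (simp add: D_def w_def)
qed

text \<open>
  The theorem for functions with values in a Banach space does not apply directly, since the plane is
  only known to be a normed space; it is applied to the two real coordinates instead.
\<close>
lemma fundamental_theorem_of_calculus_plane:
  fixes F F' :: "real \<Rightarrow> 'a"
  assumes "a \<le> c" and F: "\<And>t. t \<in> {a..c} \<Longrightarrow> (F has_vector_derivative F' t) (at t within {a..c})"
  shows "(F' has_integral F c - F a) {a..c}"
proof -
  define e f where "e = \<phi> 0" and "f = \<phi>' 0"
  have ef: "\<omega> e f \<noteq> 0" using \<omega>_\<phi>_\<phi>'_nonzero by (simp add: e_def f_def)
  note coord = coordinates[OF ef, symmetric]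
  have "((\<lambda>t. \<omega> (F' t) f) has_integral \<omega> (F c) f - \<omega> (F a) f) {a..c}"
    "((\<lambda>t. \<omega> e (F' t)) has_integral \<omega> e (F c) - \<omega> e (F a)) {a..c}"
    using has_vector_derivative_\<omega>[OF F has_vector_derivative_const[of f]]
      has_vector_derivative_\<omega>[OF has_vector_derivative_const[of e] F]
    by (intro fundamental_theorem_of_calculus[OF \<open>a \<le> c\<close>]; simp)+
  then have "((\<lambda>t. \<omega> (F' t) f / \<omega> e f) has_integral \<omega> (F c - F a) f / \<omega> e f) {a..c}"
    "((\<lambda>t. \<omega> e (F' t) / \<omega> e f) has_integral \<omega> e (F c - F a) / \<omega> e f) {a..c}"
    by (auto intro: has_integral_divide)
  from has_integral_add[OF has_integral_scaleR_left[OF this(1), of e]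
      has_integral_scaleR_left[OF this(2), of f]]
  show ?thesis by (simp only: coord)
qed

end

section \<open>Involutes\<close>

theorem theorem5p2:
  fixes \<omega> :: "'a::real_normed_vector \<Rightarrow> 'a \<Rightarrow> real"
    and \<gamma> \<eta> \<sigma> \<xi> :: "real \<Rightarrow> 'a"
    and \<alpha> \<kappa> :: "real \<Rightarrow> real"
    and c d :: real
  assumes plane: "dim (UNIV :: 'a set) = 2"
    and smooth: "smooth_unit_circle TYPE('a)"
    and strictly_convex: "strictly_convex_unit_circle TYPE('a)"
    and symplectic: "symplectic_form \<omega>"
    and c_pos: "0 < c"
    and immersion: "legendre_immersion_on {0..c} \<gamma> \<eta>"
    and curvature: "curvature_pair_on \<omega> {0..c} \<gamma> \<eta> \<alpha> \<kappa>"
    and \<kappa>_nonzero: "\<And>t. t \<in> {0..c} \<Longrightarrow> \<kappa> t \<noteq> 0"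
    and rho_nonzero: "\<And>t. t \<in> {0..c} \<Longrightarrow> rho \<omega> (\<eta> t) \<noteq> 0"
    and \<xi>_eq: "\<And>t. t \<in> {0..c} \<Longrightarrow> \<xi> t = birkhoff_map \<omega> (\<eta> t)"
    and \<sigma>_eq: "\<And>t. t \<in> {0..c} \<Longrightarrow>
       \<sigma> t = \<gamma> 0
         - integral {0..t} (\<lambda>s. integral {0..s} \<alpha> *\<^sub>R vector_derivative \<xi> (at s within {0..c}))
         + d *\<^sub>R \<xi> t"
  shows "legendre_immersion_on {0..c} \<sigma> \<xi>
    \<and> curvature_pair_on \<omega> {0..c} \<sigma> \<xi>
        (\<lambda>t. - (\<kappa> t * rho \<omega> (\<eta> t) * (- d + integral {0..t} \<alpha>)))
        (\<lambda>t. \<kappa> t * rho \<omega> (\<eta> t))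
    \<and> involute_on \<omega> {0..c} \<sigma> \<xi> \<gamma> \<eta>"
proof -
  from smooth obtain \<phi> :: "real \<Rightarrow> 'a" where \<phi>: "smooth_curve_on UNIV \<phi>"
    "\<And>s. vector_derivative \<phi> (at s) \<noteq> 0" "range \<phi> = sphere 0 1"
    unfolding smooth_unit_circle_def by blast
  interpret parametrized_unit_circle \<omega> \<phi> "\<lambda>s. vector_derivative \<phi> (at s)"
  proof
    show "(\<phi> has_vector_derivative vector_derivative \<phi> (at s)) (at s)" for s
      using times_differentiable_on_vector_derivative(1)[OF _
          smooth_curve_on_imp_times_differentiable[OF \<phi>(1), of "Suc 0"], of s] by simp
  qed (use plane symplectic \<phi> in auto)

  let ?I = "{0..c}"
  let ?R = "\<lambda>t. rho \<omega> (\<eta> t)"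
  define A where "A t = integral {0..t} \<alpha>" for t

  have perfect: "at t within ?I \<noteq> bot" if "t \<in> ?I" for t
    using that c_pos by (simp add: trivial_limit_within islimpt_Icc)
  have smooth_iff: "smooth_curve_on ?I f \<longleftrightarrow> (\<forall>k. times_differentiable_on k ?I f)"
    for f :: "real \<Rightarrow> 'b::real_normed_vector"
    using perfect by (rule smooth_curve_on_iff_times_differentiable)
  note vd = vector_derivative_within[OF perfect]

  have \<gamma>: "(\<gamma> has_vector_derivative \<alpha> t *\<^sub>R \<xi> t) (at t within ?I)"
    and \<eta>: "(\<eta> has_vector_derivative \<kappa> t *\<^sub>R \<xi> t) (at t within ?I)" if "t \<in> ?I" for t
    using curvature that by (simp_all add: curvature_pair_on_def \<xi>_eq)
  have smooth_data: "times_differentiable_on k ?I \<alpha>" "times_differentiable_on k ?I \<kappa>"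
    "times_differentiable_on k ?I \<gamma>" "times_differentiable_on k ?I \<eta>" for k
    using curvature immersion
    by (auto simp: curvature_pair_on_def legendre_immersion_on_def legendre_curve_on_def
        intro: smooth_curve_on_imp_times_differentiable)
  have norm_\<eta>: "norm (\<eta> t) = 1" if "t \<in> ?I" for t
    using immersion that by (simp add: legendre_immersion_on_def legendre_curve_on_def)
  then have \<eta>_nz: "\<eta> t \<noteq> 0" if "t \<in> ?I" for t using that by force
  have norm_\<xi>: "norm (\<xi> t) = 1" if "t \<in> ?I" for t
    using norm_birkhoff_map[OF \<eta>_nz] that by (simp add: \<xi>_eq)
  then have \<xi>_nz: "\<xi> t \<noteq> 0" if "t \<in> ?I" for t using that by force

  have \<xi>: "(\<xi> has_vector_derivative (\<kappa> t * ?R t) *\<^sub>R b (\<xi> t)) (at t within ?I)"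
    if t: "t \<in> ?I" for t
  proof -
    let ?D = "frechet_derivative b (at (\<eta> t))"
    have D: "(b has_derivative ?D) (at (\<eta> t))"
      using birkhoff_map_differentiable[OF \<eta>_nz[OF t]] by (simp add: frechet_derivative_works)
    have "?D (\<kappa> t *\<^sub>R \<xi> t) = \<kappa> t *\<^sub>R ?D (b (\<eta> t))"
      using linear_scale[OF has_derivative_linear[OF D]] \<xi>_eq[OF t] by simp
    also have "\<dots> = (\<kappa> t * ?R t) *\<^sub>R b (\<xi> t)"
      using frechet_derivative_birkhoff_map[OF \<eta>_nz[OF t]] \<xi>_eq[OF t] by simp
    finally have comp: "(b \<circ> \<eta> has_vector_derivative (\<kappa> t * ?R t) *\<^sub>R b (\<xi> t)) (at t within ?I)"
      using vector_derivative_diff_chain_within[OF \<eta>[OF t] has_derivative_at_withinI[OF D]] by simp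
    show ?thesis
      by (rule has_vector_derivative_transform[OF t _ comp]) (simp add: \<xi>_eq)
  qed

  (* The smoothness of xi is read off from eta' = kappa xi, not from b. *)
  have \<xi>_smooth: "times_differentiable_on k ?I \<xi>" for k
  proof -
    have "times_differentiable_on k ?I
        (\<lambda>t. inverse (\<kappa> t) *\<^sub>R vector_derivative \<eta> (at t within ?I))"
      using \<kappa>_nonzero
      by (intro times_differentiable_on_scaleR times_differentiable_on_inverse smooth_data
          times_differentiable_on_vector_derivative(2)[OF perfect smooth_data(4)])
    then show ?thesis
      by (rule times_differentiable_on_cong) (simp add: vd[OF _ \<eta>] \<kappa>_nonzero)
  qed
  (* The curve ?y is xi' / kappa = rho(eta) b(xi). Its norm is rho(eta) itself, whereas the norm of
     xi' would bring in the absolute value of kappa. *)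
  have R_smooth: "times_differentiable_on k ?I ?R" for k
  proof -
    let ?y = "\<lambda>t. inverse (\<kappa> t) *\<^sub>R vector_derivative \<xi> (at t within ?I)"
    have y: "?y t = ?R t *\<^sub>R b (\<xi> t)" if "t \<in> ?I" for t
      using that by (simp add: vd[OF _ \<xi>] \<kappa>_nonzero)
    have b_nz: "norm (b (\<xi> t)) = 1" if "t \<in> ?I" for t using norm_birkhoff_map[OF \<xi>_nz[OF that]] .
    have "?y t \<noteq> 0" if "t \<in> ?I" for t
      using y[OF that] b_nz[OF that] rho_nonzero[OF that] by auto
    moreover have "times_differentiable_on k ?I ?y"
      using \<kappa>_nonzero
      by (intro times_differentiable_on_scaleR times_differentiable_on_inverse smooth_data
          times_differentiable_on_vector_derivative(2)[OF perfect \<xi>_smooth])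
    ultimately have "times_differentiable_on k ?I (\<lambda>t. norm (?y t))"
      using perfect by (intro times_differentiable_on_norm)
    then show ?thesis
      by (rule times_differentiable_on_cong) (simp only: y b_nz norm_scaleR, simp add: rho_def)
  qed

  have "continuous_on ?I \<alpha>"
    using smooth_data(1)[of "Suc 0"] by (auto intro: continuous_on_vector_derivative)
  then have A: "(A has_real_derivative \<alpha> t) (at t within ?I)" if "t \<in> ?I" for t
    using integral_has_real_derivative[of 0 c \<alpha> t] that unfolding A_def by simp
  have A_smooth: "times_differentiable_on k ?I A" for k
  proof (cases k)
    case (Suc j)
    show ?thesis unfolding Suc
      using A smooth_data(1)
      by (intro times_differentiable_on_SucI[where f'=\<alpha>])
         (auto simp: has_real_derivative_iff_has_vector_derivative)
  qed simp

  (* Integration by parts: A xi' = (A xi)' - alpha xi = (A xi - gamma)'. *)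
  have \<sigma>_formula: "\<sigma> t = \<gamma> t + (d - A t) *\<^sub>R \<xi> t" if t: "t \<in> ?I" for t
  proof -
    let ?F = "\<lambda>s. A s *\<^sub>R \<xi> s - \<gamma> s"
    have "((\<lambda>s. A s *\<^sub>R vector_derivative \<xi> (at s within ?I)) has_integral ?F t - ?F 0) {0..t}"
    proof (rule fundamental_theorem_of_calculus_plane)
      fix s assume "s \<in> {0..t}"
      then have s: "s \<in> ?I" using t by simp
      have "(?F has_vector_derivative
          A s *\<^sub>R vector_derivative \<xi> (at s within ?I) + \<alpha> s *\<^sub>R \<xi> s - \<alpha> s *\<^sub>R \<xi> s) (at s within ?I)"
        unfolding vd[OF s \<xi>[OF s]]
        by (intro has_vector_derivative_diff has_vector_derivative_scaleR A \<xi> \<gamma> s)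
      then show "(?F has_vector_derivative A s *\<^sub>R vector_derivative \<xi> (at s within ?I)) (at s within {0..t})"
        using t by (auto intro: has_vector_derivative_within_subset)
    qed (use t in simp)
    moreover have "A 0 = 0" by (simp add: A_def)
    ultimately have int_eq: "integral {0..t} (\<lambda>s. A s *\<^sub>R vector_derivative \<xi> (at s within ?I))
        = A t *\<^sub>R \<xi> t - \<gamma> t + \<gamma> 0"
      by (simp add: integral_unique)
    have "\<sigma> t = \<gamma> 0 - integral {0..t} (\<lambda>s. A s *\<^sub>R vector_derivative \<xi> (at s within ?I)) + d *\<^sub>R \<xi> t"
      using \<sigma>_eq[OF t] by (simp add: A_def)
    then show ?thesis unfolding int_eq by (simp add: algebra_simps)
  qed
  have \<sigma>: "(\<sigma> has_vector_derivative (- (\<kappa> t * ?R t * (- d + A t))) *\<^sub>R b (\<xi> t)) (at t within ?I)"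
    if t: "t \<in> ?I" for t
  proof -
    have "((\<lambda>t. \<gamma> t + (d - A t) *\<^sub>R \<xi> t) has_vector_derivative
        \<alpha> t *\<^sub>R \<xi> t + ((d - A t) *\<^sub>R ((\<kappa> t * ?R t) *\<^sub>R b (\<xi> t)) + (0 - \<alpha> t) *\<^sub>R \<xi> t)) (at t within ?I)"
      by (intro has_vector_derivative_add has_vector_derivative_scaleR DERIV_diff DERIV_const A \<xi> \<gamma> t)
    then have deriv: "((\<lambda>t. \<gamma> t + (d - A t) *\<^sub>R \<xi> t) has_vector_derivative
        (- (\<kappa> t * ?R t * (- d + A t))) *\<^sub>R b (\<xi> t)) (at t within ?I)"
      by (simp add: algebra_simps)
    show ?thesis
      by (rule has_vector_derivative_transform[OF t _ deriv]) (rule \<sigma>_formula)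
  qed
  have \<sigma>_smooth: "times_differentiable_on k ?I \<sigma>" for k
  proof -
    (* The difference d - A t is written with addition and multiplication to fit the closure rules. *)
    have "times_differentiable_on k ?I (\<lambda>t. \<gamma> t + (d + (- 1) * A t) *\<^sub>R \<xi> t)"
      by (intro times_differentiable_on_add times_differentiable_on_scaleR times_differentiable_on_mult
          times_differentiable_on_const smooth_data A_smooth \<xi>_smooth)
    then show ?thesis
      by (rule times_differentiable_on_cong) (simp add: \<sigma>_formula)
  qed

  have pair: "curvature_pair_on \<omega> ?I \<sigma> \<xi>
      (\<lambda>t. - (\<kappa> t * ?R t * (- d + A t))) (\<lambda>t. \<kappa> t * ?R t)"
  proof -
    have "times_differentiable_on k ?I (\<lambda>t. \<kappa> t * ?R t)" for k
      by (intro times_differentiable_on_mult smooth_data R_smooth)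
    moreover have "times_differentiable_on k ?I (\<lambda>t. (- 1) * (\<kappa> t * ?R t * (- d + A t)))" for k
      by (intro times_differentiable_on_mult times_differentiable_on_add times_differentiable_on_const
          smooth_data R_smooth A_smooth)
    ultimately show ?thesis
      unfolding curvature_pair_on_def smooth_iff using \<sigma> \<xi> by simp
  qed
  have nz: "\<kappa> t * ?R t \<noteq> 0" if "t \<in> ?I" for t using \<kappa>_nonzero rho_nonzero that by simp
  have imm: "legendre_immersion_on ?I \<sigma> \<xi>"
    unfolding legendre_immersion_on_def legendre_curve_on_def smooth_iff
  proof (intro conjI ballI allI)
    fix t assume t: "t \<in> ?I"
    show "birkhoff_orth (\<xi> t) (vector_derivative \<sigma> (at t within ?I))"
      using birkhoff_orth_birkhoff_map[OF \<xi>_nz[OF t]]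
      unfolding vd[OF t \<sigma>[OF t]] by (simp add: birkhoff_orth_def del: scaleR_minus_left)
    have "vector_derivative \<xi> (at t within ?I) \<noteq> 0"
      using nz[OF t] norm_birkhoff_map[OF \<xi>_nz[OF t]] unfolding vd[OF t \<xi>[OF t]] by auto
    then show "\<not> (vector_derivative \<sigma> (at t within ?I) = 0 \<and> vector_derivative \<xi> (at t within ?I) = 0)"
      by simp
  qed (simp_all add: \<sigma>_smooth \<xi>_smooth norm_\<xi>)
  have "evolute \<sigma> \<xi> (\<lambda>t. - (\<kappa> t * ?R t * (- d + A t))) (\<lambda>t. \<kappa> t * ?R t) t = \<gamma> t"
    if t: "t \<in> ?I" for t
  proof -
    have "- (\<kappa> t * ?R t * (- d + A t)) / (\<kappa> t * ?R t) = d - A t"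
      using nz[OF t] by (simp add: field_simps)
    then show ?thesis by (simp only: evolute_def \<sigma>_formula[OF t] add_diff_cancel_right')
  qed
  then have "involute_on \<omega> ?I \<sigma> \<xi> \<gamma> \<eta>"
    unfolding involute_on_def
    using immersion curvature \<kappa>_nonzero imm pair nz by blast
  with imm pair show ?thesis unfolding A_def by blast
qed

end
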